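(* Let $n=2^\eta$ with $\eta\ge1$ an integer, and let $\mu:G_n\to[0,1]$ be a probability measure on the $n\times n$ unit grid $G_n$ (with cyclic boundary conditions). Let $\varepsilon_1,\varepsilon_2$ be independent random signed measures on $G_n$, each distributed according to the zero-sum Gaussian noise model with parameter $\sigma>0$ described in the context. Then, for every $p\in\mathbb N$ with $p>1$, $$\mathbb{E}\Big[\big(W_p^{\pm}(\mu+\varepsilon_1,\mu+\varepsilon_2)\big)^p\Big]\le\frac{4\sqrt2}{\sqrt\pi}\,n\sigma ,$$ and $$C_p\,n^{\frac2p-1}\sigma^{\frac1p}\ \le\ \mathbb{E}\,W_p^{\pm}(\mu+\varepsilon_1,\mu+\varepsilon_2)\ \le\ \Big(\frac{4\sqrt2}{\sqrt\pi}\,n\sigma\Big)^{\frac1p},\qquad\text{where } C_p:=\frac{2^{\frac1p-1}}{\sqrt\pi}\,\Gamma\Big(\frac1{2p}+\frac12\Big)$$ and $\Gamma$ is Euler's Gamma function.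
   Context: $G_n=\{0,\tfrac1n,\dots,\tfrac{n-1}{n}\}^2$ is the $n\times n$ unit pixel grid with cyclic boundary conditions, with ground distance $\mathsf d$ the Euclidean (flat torus) distance $\mathsf d(x,y)=\big(\sum_{i=1}^2\min(|x_i-y_i|,1-|x_i-y_i|)^2\big)^{1/2}$. Functions on $G_n$ are identified with signed measures on $G_n$ (the value at a pixel is its point mass); $a_+=\max(a,0)$, $a_-=\max(-a,0)$ pixelwise. Zero-sum Gaussian noise model: with $m=n^2$, the vector of noise values $(\varepsilon(x))_{x\in G_n}$ is distributed as $\mathcal N(0,\Sigma)$, where $\Sigma$ is the $m\times m$ matrix with diagonal entries $\sigma^2$ and off-diagonal entries $-\sigma^2/(m-1)$. In particular $\sum_x\varepsilon(x)=0$ almost surely. For $p\in\mathbb N$, $p\ge1$, and nonnegative measures $\alpha,\beta$ on $G_n$ of equal total mass, $W_p(\alpha,\beta)=\big(\inf_{\pi}\sum_{x,y}\mathsf d(x,y)^p\pi(x,y)\big)^{1/p}$, where the infimum is over all nonnegative measures $\pi$ on $G_n\times G_n$ with marginals $\alpha,\beta$. For signed measures $\rho,\tau$ on $G_n$ of equal total mass, the signed Wasserstein discrepancy is $W_p^{\pm}(\rho,\tau)=W_p(\rho_++\tau_-,\ \tau_++\rho_-)$. *)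

theory Defs
  imports "HOL-Probability.Probability"
begin

text \<open>
  A signed measure on the grid is represented by its point masses, i.e. by a function on the
  plane of which only the values on the grid matter.
\<close>

definition grid :: "nat \<Rightarrow> (real \<times> real) set" where
  "grid n = {(real i / real n, real j / real n) | i j. i < n \<and> j < n}"

definition torus_dist :: "real \<times> real \<Rightarrow> real \<times> real \<Rightarrow> real" where
  "torus_dist x y = sqrt ((min \<bar>fst x - fst y\<bar> (1 - \<bar>fst x - fst y\<bar>))\<^sup>2
                        + (min \<bar>snd x - snd y\<bar> (1 - \<bar>snd x - snd y\<bar>))\<^sup>2)"

definition couplings ::
    "nat \<Rightarrow> (real \<times> real \<Rightarrow> real) \<Rightarrow> (real \<times> real \<Rightarrow> real) \<Rightarrow>
     (real \<times> real \<Rightarrow> real \<times> real \<Rightarrow> real) set" where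
  "couplings n \<alpha> \<beta> = {\<pi>. (\<forall>x\<in>grid n. \<forall>y\<in>grid n. 0 \<le> \<pi> x y) \<and>
                        (\<forall>x\<in>grid n. (\<Sum>y\<in>grid n. \<pi> x y) = \<alpha> x) \<and>
                        (\<forall>y\<in>grid n. (\<Sum>x\<in>grid n. \<pi> x y) = \<beta> y)}"

text \<open>
  Meaningful for nonnegative measures of equal total mass; otherwise there is no coupling and
  the infimum is over the empty set, so the value is unspecified.
\<close>

definition wasserstein ::
    "nat \<Rightarrow> nat \<Rightarrow> (real \<times> real \<Rightarrow> real) \<Rightarrow> (real \<times> real \<Rightarrow> real) \<Rightarrow> real" where
  "wasserstein n p \<alpha> \<beta> =
     (INF \<pi>\<in>couplings n \<alpha> \<beta>. \<Sum>x\<in>grid n. \<Sum>y\<in>grid n. torus_dist x y ^ p * \<pi> x y) powr (1 / real p)"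

definition signed_wasserstein ::
    "nat \<Rightarrow> nat \<Rightarrow> (real \<times> real \<Rightarrow> real) \<Rightarrow> (real \<times> real \<Rightarrow> real) \<Rightarrow> real" where
  "signed_wasserstein n p \<rho> \<tau> =
     wasserstein n p (\<lambda>x. max (\<rho> x) 0 + max (- \<tau> x) 0) (\<lambda>x. max (\<tau> x) 0 + max (- \<rho> x) 0)"

text \<open>
  The multivariate normal law \<open>N(m, \<Sigma>)\<close> on a finite index set \<open>I\<close>, given by its characteristic
  function \<open>t \<mapsto> exp (i t\<^sup>Tm - t\<^sup>T\<Sigma>t / 2)\<close>. This covers singular \<open>\<Sigma>\<close>, for which there is no
  density; the noise covariance below is singular.
\<close>

definition gaussian_vector ::
    "'a measure \<Rightarrow> 'i set \<Rightarrow> ('i \<Rightarrow> real) \<Rightarrow> ('i \<Rightarrow> 'i \<Rightarrow> real) \<Rightarrow> ('a \<Rightarrow> 'i \<Rightarrow> real) \<Rightarrow> bool" where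
  "gaussian_vector M I m S X \<longleftrightarrow>
     (\<forall>i\<in>I. (\<lambda>\<omega>. X \<omega> i) \<in> borel_measurable M) \<and>
     (\<forall>t. (CLINT \<omega>|M. iexp (\<Sum>i\<in>I. t i * X \<omega> i)) =
            exp (\<i> * of_real (\<Sum>i\<in>I. t i * m i)
                 - of_real (\<Sum>i\<in>I. \<Sum>j\<in>I. t i * S i j * t j) / 2))"

definition noise_cov :: "nat \<Rightarrow> real \<Rightarrow> real \<times> real \<Rightarrow> real \<times> real \<Rightarrow> real" where
  "noise_cov n \<sigma> x y = (if x = y then \<sigma>\<^sup>2 else - \<sigma>\<^sup>2 / (real (n\<^sup>2) - 1))"

definition zero_sum_gaussian_noise ::
    "'a measure \<Rightarrow> nat \<Rightarrow> real \<Rightarrow> ('a \<Rightarrow> real \<times> real \<Rightarrow> real) \<Rightarrow> bool" where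
  "zero_sum_gaussian_noise M n \<sigma> \<epsilon> \<longleftrightarrow> gaussian_vector M (grid n) (\<lambda>_. 0) (noise_cov n \<sigma>) \<epsilon>"

end

theory Submission
  imports Defs
begin

text \<open>
  The two measures that \<open>W\<close> compares differ by the noise difference \<open>\<epsilon>1 - \<epsilon>2\<close> alone: the common part
\<open>\<mu>\<close> cancels, because \<open>max a 0 - max (- a) 0 = a\<close>. The total noise is almost surely zero, so couplings
exist almost surely, and the \<open>p\<close>-th power of \<open>W\<close> is then the optimal transport cost \<open>V\<close>. Both bounds
control \<open>V\<close> by sums of absolute values of the noise difference over blocks of pixels, whose laws are
explicit centred Gaussians.

For the upper bound, mass is matched from fine to coarse along the dyadic subdivision of the torus
(\<open>multiscale_coupling\<close>). After everything possible has been matched inside the cells of side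
\<open>2\<^sup>-\<^sup>j\<^sup>-\<^sup>1\<close>, each of these cells holds only surplus or only deficit, of size \<open>\<bar>(\<epsilon>1 - \<epsilon>2)(Q)\<bar>\<close>. Matching at the
next coarser level moves at most half the total of these, at unit cost at most the squared diameter of
a cell (as \<open>p \<ge> 2\<close> and all distances are below 1). A block of \<open>N\<close> pixels carries
a Gaussian of variance at most \<open>2\<sigma>\<^sup>2N\<close>, since the covariances are negative; by the Cauchy-Schwarz
inequality the discrepancies at level \<open>j\<close> add up in expectation to at most \<open>2\<sigma>/\<surd>\<pi> \<cdot> 2\<^sup>j n\<close>
(\<open>level_discrepancy\<close>). The squared diameters decay like \<open>4\<^sup>-\<^sup>j\<close>, so the sum over the levels is
geometric and yields \<open>5n\<sigma>/\<surd>\<pi>\<close>, which is below \<open>4\<surd>2 n\<sigma>/\<surd>\<pi>\<close>.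

For the lower bound, half of the total variation of the noise difference has to leave its pixel, and
distinct pixels are at distance at least \<open>1/n\<close> (\<open>coupling_cost_ge\<close>). Taking \<open>p\<close>-th roots, the power mean
inequality replaces the root of the sum by a sum of roots (\<open>root_cost_ge_mean_roots\<close>), whose expectation
is a Gaussian absolute moment of order \<open>1/p\<close>; this is where the Gamma function comes from
(\<open>std_normal_abs_moment\<close>). The upper bound for the mean of \<open>W\<close> follows from the one for its \<open>p\<close>-th power
by Jensen's inequality.

Integrability requires measurability of an infimum over an uncountable set of couplings that itself
varies with the noise. By \<open>optimal_cost_less_iff\<close>, the event that the infimum is below a threshold is
a countable union of elementary events indexed by rational partial transport plans.
\<close>


section \<open>Couplings on a finite set\<close>

text \<open>
  The plan that matches as much as possible inside every cell of the partition given by \<open>c\<close>. In a cell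
with masses \<open>A\<close> and \<open>B\<close> of \<open>a\<close> and \<open>b\<close>, the product plan scaled by \<open>1 / max A B\<close> exhausts the smaller
side and takes the same proportion from every point of the larger one. A cell without mass gives
\<open>0 / 0 = 0\<close>, as it should.
\<close>

definition cell_plan :: "'x set \<Rightarrow> ('x \<Rightarrow> 'c) \<Rightarrow> ('x \<Rightarrow> real) \<Rightarrow> ('x \<Rightarrow> real) \<Rightarrow> 'x \<Rightarrow> 'x \<Rightarrow> real" where
  "cell_plan X c a b x y =
     (if c x = c y
      then a x * b y / max (\<Sum>z | z \<in> X \<and> c z = c x. a z) (\<Sum>z | z \<in> X \<and> c z = c x. b z)
      else 0)"

lemma cell_plan_outside: "c x \<noteq> c y \<Longrightarrow> cell_plan X c a b x y = 0"
  by (simp add: cell_plan_def)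

lemma cell_plan_swap: "cell_plan X c a b x y = cell_plan X c b a y x"
  by (simp add: cell_plan_def max.commute mult.commute)

lemma cell_plan_nonneg:
  assumes "\<And>x. x \<in> X \<Longrightarrow> 0 \<le> a x" "\<And>x. x \<in> X \<Longrightarrow> 0 \<le> b x" "x \<in> X" "y \<in> X"
  shows "0 \<le> cell_plan X c a b x y"
  unfolding cell_plan_def using assms
  by (auto intro!: divide_nonneg_nonneg sum_nonneg simp: le_max_iff_disj)

lemma cell_plan_row:
  assumes "finite X"
  shows "(\<Sum>y\<in>X. cell_plan X c a b x y)
    = a x * ((\<Sum>z | z \<in> X \<and> c z = c x. b z) /
             max (\<Sum>z | z \<in> X \<and> c z = c x. a z) (\<Sum>z | z \<in> X \<and> c z = c x. b z))"
proof -
  have "(\<Sum>y\<in>X. cell_plan X c a b x y) = (\<Sum>y | y \<in> X \<and> c y = c x. a x * b y /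
             max (\<Sum>z | z \<in> X \<and> c z = c x. a z) (\<Sum>z | z \<in> X \<and> c z = c x. b z))"
    unfolding cell_plan_def by (rule sum.mono_neutral_cong_right) (use assms in auto)
  then show ?thesis
    by (simp add: sum_distrib_left sum_divide_distrib)
qed

lemma cell_plan_row_le:
  assumes "finite X" and a: "\<And>x. x \<in> X \<Longrightarrow> 0 \<le> a x" and b: "\<And>x. x \<in> X \<Longrightarrow> 0 \<le> b x" and "x \<in> X"
  shows "(\<Sum>y\<in>X. cell_plan X c a b x y) \<le> a x"
proof -
  have ratio: "s / max r s \<le> 1" if "0 \<le> r" "0 \<le> s" for r s :: real
    using that by (auto simp: divide_le_eq_1 max_def)
  show ?thesis
    unfolding cell_plan_row[OF assms(1)]
    by (intro mult_left_le ratio sum_nonneg) (use a b assms(4) in auto)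
qed

text \<open>
  After matching, a cell retains only its surplus of \<open>a\<close> over \<open>b\<close>: the side with less mass is used up.
\<close>

lemma cell_plan_row_rest:
  assumes "finite X" and a: "\<And>x. x \<in> X \<Longrightarrow> 0 \<le> a x" and b: "\<And>x. x \<in> X \<Longrightarrow> 0 \<le> b x"
  shows "(\<Sum>x | x \<in> X \<and> c x = k. a x - (\<Sum>y\<in>X. cell_plan X c a b x y))
       = max ((\<Sum>x | x \<in> X \<and> c x = k. a x) - (\<Sum>x | x \<in> X \<and> c x = k. b x)) 0"
    (is "_ = max (?A - ?B) 0")
proof -
  have rest: "r - r * (s / max r s) = max (r - s) 0" if "0 \<le> r" "0 \<le> s" for r s :: real
    using that by (auto simp: max_def field_simps)
  have "(\<Sum>x | x \<in> X \<and> c x = k. a x - (\<Sum>y\<in>X. cell_plan X c a b x y))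
      = (\<Sum>x | x \<in> X \<and> c x = k. a x - a x * (?B / max ?A ?B))"
    unfolding cell_plan_row[OF assms(1)] by (rule sum.cong) auto
  also have "\<dots> = ?A - ?A * (?B / max ?A ?B)"
    by (simp only: sum_subtractf sum_distrib_right)
  also have "\<dots> = max (?A - ?B) 0"
    by (intro rest sum_nonneg) (use a b in auto)
  finally show ?thesis .
qed

lemma cell_plan_col_le:
  assumes "finite X" and "\<And>x. x \<in> X \<Longrightarrow> 0 \<le> a x" and "\<And>x. x \<in> X \<Longrightarrow> 0 \<le> b x" and "y \<in> X"
  shows "(\<Sum>x\<in>X. cell_plan X c a b x y) \<le> b y"
  using cell_plan_row_le[of X b a y c] assms by (subst cell_plan_swap) blast

lemma cell_plan_col_rest:
  assumes "finite X" and "\<And>x. x \<in> X \<Longrightarrow> 0 \<le> a x" and "\<And>x. x \<in> X \<Longrightarrow> 0 \<le> b x"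
  shows "(\<Sum>y | y \<in> X \<and> c y = k. b y - (\<Sum>x\<in>X. cell_plan X c a b x y))
       = max ((\<Sum>x | x \<in> X \<and> c x = k. b x) - (\<Sum>x | x \<in> X \<and> c x = k. a x)) 0"
  using cell_plan_row_rest[of X b a c k] assms by (subst cell_plan_swap) blast

text \<open>
  The two remainders left by a partial plan have equal mass, so a scaled product of them fills the plan
up; the added cost is at most the missing mass times the largest unit cost.
\<close>

lemma subcoupling_completion:
  fixes a b :: "'x \<Rightarrow> real" and q d :: "'x \<Rightarrow> 'x \<Rightarrow> real"
  assumes X: "finite X" and mass: "sum a X = sum b X"
    and q: "\<And>x y. x \<in> X \<Longrightarrow> y \<in> X \<Longrightarrow> 0 \<le> q x y"
    and qa: "\<And>x. x \<in> X \<Longrightarrow> (\<Sum>y\<in>X. q x y) \<le> a x"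
    and qb: "\<And>y. y \<in> X \<Longrightarrow> (\<Sum>x\<in>X. q x y) \<le> b y"
    and d: "\<And>x y. x \<in> X \<Longrightarrow> y \<in> X \<Longrightarrow> d x y \<le> K"
  obtains \<pi> where
    "\<And>x y. x \<in> X \<Longrightarrow> y \<in> X \<Longrightarrow> 0 \<le> \<pi> x y"
    "\<And>x. x \<in> X \<Longrightarrow> (\<Sum>y\<in>X. \<pi> x y) = a x"
    "\<And>y. y \<in> X \<Longrightarrow> (\<Sum>x\<in>X. \<pi> x y) = b y"
    "(\<Sum>x\<in>X. \<Sum>y\<in>X. d x y * \<pi> x y)
       \<le> (\<Sum>x\<in>X. \<Sum>y\<in>X. d x y * q x y) + K * (sum a X - (\<Sum>x\<in>X. \<Sum>y\<in>X. q x y))"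
proof -
  define a' where "a' x = a x - (\<Sum>y\<in>X. q x y)" for x
  define b' where "b' y = b y - (\<Sum>x\<in>X. q x y)" for y
  have mass': "sum a' X = sum b' X"
    unfolding a'_def b'_def sum_subtractf mass by (subst sum.swap) simp
  have a'0: "0 \<le> a' x" and b'0: "0 \<le> b' x" if "x \<in> X" for x
    using qa qb that by (auto simp: a'_def b'_def)
  define \<rho> where "\<rho> = cell_plan X (\<lambda>_. ()) a' b'"
  have \<rho>1: "0 \<le> \<rho> x y" if "x \<in> X" "y \<in> X" for x y
    unfolding \<rho>_def by (rule cell_plan_nonneg[OF a'0 b'0 that])
  have \<rho>2: "(\<Sum>y\<in>X. \<rho> x y) \<le> a' x" if "x \<in> X" for x
    unfolding \<rho>_def by (rule cell_plan_row_le[OF X a'0 b'0 that])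
  have \<rho>3: "(\<Sum>x\<in>X. \<rho> x y) \<le> b' y" if "y \<in> X" for y
    unfolding \<rho>_def by (rule cell_plan_col_le[OF X a'0 b'0 that])
  have \<rho>4: "(\<Sum>x\<in>X. a' x - (\<Sum>y\<in>X. \<rho> x y)) = 0"
    using cell_plan_row_rest[OF X a'0 b'0, where c="\<lambda>_. ()" and k="()"] mass' by (simp add: \<rho>_def)
  have \<rho>5: "(\<Sum>y\<in>X. b' y - (\<Sum>x\<in>X. \<rho> x y)) = 0"
    using cell_plan_col_rest[OF X a'0 b'0, where c="\<lambda>_. ()" and k="()"] mass' by (simp add: \<rho>_def)
  have rowr: "(\<Sum>y\<in>X. \<rho> x y) = a' x" if "x \<in> X" for x
    using \<rho>4 \<rho>2 that X by (subst (asm) sum_nonneg_eq_0_iff) auto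
  have colr: "(\<Sum>x\<in>X. \<rho> x y) = b' y" if "y \<in> X" for y
    using \<rho>5 \<rho>3 that X by (subst (asm) sum_nonneg_eq_0_iff) auto
  show thesis
  proof (rule that[of "\<lambda>x y. q x y + \<rho> x y"])
    show "0 \<le> q x y + \<rho> x y" if "x \<in> X" "y \<in> X" for x y
      using q \<rho>1 that by simp
    show "(\<Sum>y\<in>X. q x y + \<rho> x y) = a x" if "x \<in> X" for x
      using rowr[OF that] by (simp add: sum.distrib a'_def)
    show "(\<Sum>x\<in>X. q x y + \<rho> x y) = b y" if "y \<in> X" for y
      using colr[OF that] by (simp add: sum.distrib b'_def)
    have "(\<Sum>x\<in>X. \<Sum>y\<in>X. d x y * \<rho> x y) \<le> (\<Sum>x\<in>X. \<Sum>y\<in>X. K * \<rho> x y)"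
      by (intro sum_mono mult_right_mono d \<rho>1)
    also have "\<dots> = K * (\<Sum>x\<in>X. a' x)"
      by (simp add: sum_distrib_left[symmetric] rowr)
    also have "(\<Sum>x\<in>X. a' x) = sum a X - (\<Sum>x\<in>X. \<Sum>y\<in>X. q x y)"
      by (simp add: a'_def sum_subtractf)
    finally show "(\<Sum>x\<in>X. \<Sum>y\<in>X. d x y * (q x y + \<rho> x y))
       \<le> (\<Sum>x\<in>X. \<Sum>y\<in>X. d x y * q x y) + K * (sum a X - (\<Sum>x\<in>X. \<Sum>y\<in>X. q x y))"
      by (simp add: distrib_left sum.distrib)
  qed
qed

text \<open>
  A coarse cell is a disjoint union of fine cells, so functions with equal sums over all fine cells
have equal sums over all coarse cells.
\<close>

lemma coarser_cell_sum_cong: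
  fixes f g :: "'x \<Rightarrow> real"
  assumes X: "finite X"
    and fine: "\<And>k. k \<in> c ` X \<Longrightarrow> (\<Sum>x | x \<in> X \<and> c x = k. f x) = (\<Sum>x | x \<in> X \<and> c x = k. g x)"
    and nested: "\<And>x y. x \<in> X \<Longrightarrow> y \<in> X \<Longrightarrow> c x = c y \<Longrightarrow> c' x = c' y"
  shows "(\<Sum>x | x \<in> X \<and> c' x = l. f x) = (\<Sum>x | x \<in> X \<and> c' x = l. g x)"
proof -
  let ?P = "{x \<in> X. c' x = l}"
  have cell: "{x \<in> ?P. c x = k} = {x \<in> X. c x = k}" if "k \<in> c ` ?P" for k
    using that by (auto dest: nested)
  have "sum f ?P = (\<Sum>k\<in>c ` ?P. \<Sum>x | x \<in> ?P \<and> c x = k. f x)"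
    by (rule sum.image_gen) (use X in simp)
  also have "\<dots> = (\<Sum>k\<in>c ` ?P. \<Sum>x | x \<in> ?P \<and> c x = k. g x)"
  proof (rule sum.cong[OF refl])
    fix k assume k: "k \<in> c ` ?P"
    show "(\<Sum>x | x \<in> ?P \<and> c x = k. f x) = (\<Sum>x | x \<in> ?P \<and> c x = k. g x)"
      using fine[of k] k by (subst (1 2) cell[OF k]) auto
  qed
  also have "\<dots> = sum g ?P"
    by (rule sum.image_gen[symmetric]) (use X in simp)
  finally show ?thesis .
qed

text \<open>
  The coupling is built from the finest level \<open>N\<close>, where cells are points and matching costs nothing, up
to level \<open>0\<close>, where the whole set is a single cell and equality of the masses leaves no remainder. When
level \<open>j\<close> is treated, the remainder in each cell of level \<open>j + 1\<close> is purely surplus or purely deficit, so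
the mass still to be placed is half of the sum of the discrepancies of level \<open>j + 1\<close>, and what is matched
now is moved at unit cost at most \<open>D j\<close>.
\<close>

lemma multiscale_coupling:
  fixes a b :: "'x \<Rightarrow> real" and d :: "'x \<Rightarrow> 'x \<Rightarrow> real" and c :: "nat \<Rightarrow> 'x \<Rightarrow> 'c" and D :: "nat \<Rightarrow> real"
  assumes X: "finite X"
    and a: "\<And>x. x \<in> X \<Longrightarrow> 0 \<le> a x" and b: "\<And>x. x \<in> X \<Longrightarrow> 0 \<le> b x"
    and mass: "sum a X = sum b X"
    and top: "\<And>x y. x \<in> X \<Longrightarrow> y \<in> X \<Longrightarrow> c 0 x = c 0 y"
    and nested: "\<And>j x y. j < N \<Longrightarrow> x \<in> X \<Longrightarrow> y \<in> X \<Longrightarrow> c (Suc j) x = c (Suc j) y \<Longrightarrow> c j x = c j y"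
    and bottom: "inj_on (c N) X"
    and diag: "\<And>x. x \<in> X \<Longrightarrow> d x x = 0"
    and diam: "\<And>j x y. j < N \<Longrightarrow> x \<in> X \<Longrightarrow> y \<in> X \<Longrightarrow> c j x = c j y \<Longrightarrow> d x y \<le> D j"
    and D: "\<And>j. 0 \<le> D j"
  obtains \<pi> where
    "\<And>x y. x \<in> X \<Longrightarrow> y \<in> X \<Longrightarrow> 0 \<le> \<pi> x y"
    "\<And>x. x \<in> X \<Longrightarrow> (\<Sum>y\<in>X. \<pi> x y) = a x"
    "\<And>y. y \<in> X \<Longrightarrow> (\<Sum>x\<in>X. \<pi> x y) = b y"
    "(\<Sum>x\<in>X. \<Sum>y\<in>X. d x y * \<pi> x y)
       \<le> (\<Sum>j<N. D j / 2 * (\<Sum>k\<in>c (Suc j) ` X. \<bar>\<Sum>x | x \<in> X \<and> c (Suc j) x = k. a x - b x\<bar>))"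
proof -
  define S where "S j k = (\<Sum>x | x \<in> X \<and> c j x = k. a x - b x)" for j k
  \<comment> \<open>The state once the levels \<open>N\<close> down to \<open>j\<close> are treated: a plan \<open>\<pi>\<close> and the remainders \<open>a'\<close>, \<open>b'\<close>.\<close>
  define inv where "inv j \<pi> a' b' \<longleftrightarrow>
     (\<forall>x\<in>X. \<forall>y\<in>X. 0 \<le> \<pi> x y) \<and> (\<forall>x\<in>X. 0 \<le> a' x) \<and> (\<forall>x\<in>X. 0 \<le> b' x) \<and>
     (\<forall>x\<in>X. (\<Sum>y\<in>X. \<pi> x y) + a' x = a x) \<and>
     (\<forall>y\<in>X. (\<Sum>x\<in>X. \<pi> x y) + b' y = b y) \<and>
     (\<forall>k\<in>c j ` X. (\<Sum>x | x \<in> X \<and> c j x = k. a' x) = max (S j k) 0) \<and>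
     (\<forall>k\<in>c j ` X. (\<Sum>x | x \<in> X \<and> c j x = k. b' x) = max (- S j k) 0) \<and>
     (\<Sum>x\<in>X. \<Sum>y\<in>X. d x y * \<pi> x y) \<le> (\<Sum>i=j..<N. D i / 2 * (\<Sum>k\<in>c (Suc i) ` X. \<bar>S (Suc i) k\<bar>))"
    for j \<pi> a' b'
  have "\<exists>\<pi> a' b'. inv 0 \<pi> a' b'"
  proof (rule inc_induct[of 0 N])
    define \<pi> where "\<pi> x y = (if x = y then min (a x) (b x) else 0)" for x y
    have row: "(\<Sum>y\<in>X. \<pi> x y) = min (a x) (b x)" if "x \<in> X" for x
      using that X by (simp add: \<pi>_def)
    have col: "(\<Sum>x\<in>X. \<pi> x y) = min (a y) (b y)" if "y \<in> X" for y
    proof -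
      have "(\<Sum>x\<in>X. \<pi> x y) = (\<Sum>x\<in>X. if x = y then min (a y) (b y) else 0)"
        by (rule sum.cong) (auto simp: \<pi>_def)
      then show ?thesis using that X by simp
    qed
    have single: "{x \<in> X. c N x = c N z} = {z}" if "z \<in> X" for z
      using bottom that by (auto simp: inj_on_def)
    have zero: "(\<Sum>x\<in>X. \<Sum>y\<in>X. d x y * \<pi> x y) = 0"
      by (intro sum.neutral ballI) (auto simp: \<pi>_def diag)
    have "inv N \<pi> (\<lambda>x. max (a x - b x) 0) (\<lambda>x. max (b x - a x) 0)"
      unfolding inv_def using a b row col single zero
      by (auto simp: S_def \<pi>_def)
    then show "\<exists>\<pi> a' b'. inv N \<pi> a' b'" by blast
  next
    fix j assume j: "0 \<le> j" "j < N" and "\<exists>\<pi> a' b'. inv (Suc j) \<pi> a' b'"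
    then obtain \<pi> a' b' where I: "inv (Suc j) \<pi> a' b'" by blast
    have I1: "\<And>x y. x \<in> X \<Longrightarrow> y \<in> X \<Longrightarrow> 0 \<le> \<pi> x y" "\<And>x. x \<in> X \<Longrightarrow> 0 \<le> a' x" "\<And>x. x \<in> X \<Longrightarrow> 0 \<le> b' x"
      "\<And>x. x \<in> X \<Longrightarrow> (\<Sum>y\<in>X. \<pi> x y) + a' x = a x"
      "\<And>y. y \<in> X \<Longrightarrow> (\<Sum>x\<in>X. \<pi> x y) + b' y = b y"
      and I2: "\<And>k. k \<in> c (Suc j) ` X \<Longrightarrow> (\<Sum>x | x \<in> X \<and> c (Suc j) x = k. a' x) = max (S (Suc j) k) 0"
      "\<And>k. k \<in> c (Suc j) ` X \<Longrightarrow> (\<Sum>x | x \<in> X \<and> c (Suc j) x = k. b' x) = max (- S (Suc j) k) 0"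
      and I3: "(\<Sum>x\<in>X. \<Sum>y\<in>X. d x y * \<pi> x y)
         \<le> (\<Sum>i=Suc j..<N. D i / 2 * (\<Sum>k\<in>c (Suc i) ` X. \<bar>S (Suc i) k\<bar>))"
      using I unfolding inv_def by blast+
    define \<rho> where "\<rho> = cell_plan X (c j) a' b'"
    have \<rho>1: "0 \<le> \<rho> x y" if "x \<in> X" "y \<in> X" for x y
      unfolding \<rho>_def by (rule cell_plan_nonneg[OF I1(2,3) that])
    have \<rho>2: "\<rho> x y = 0" if "c j x \<noteq> c j y" for x y
      using that unfolding \<rho>_def by (rule cell_plan_outside)
    have \<rho>3: "(\<Sum>y\<in>X. \<rho> x y) \<le> a' x" if "x \<in> X" for x
      unfolding \<rho>_def by (rule cell_plan_row_le[OF X I1(2,3) that])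
    have \<rho>4: "(\<Sum>x\<in>X. \<rho> x y) \<le> b' y" if "y \<in> X" for y
      unfolding \<rho>_def by (rule cell_plan_col_le[OF X I1(2,3) that])
    have \<rho>5: "(\<Sum>x | x \<in> X \<and> c j x = k. a' x - (\<Sum>y\<in>X. \<rho> x y))
          = max ((\<Sum>x | x \<in> X \<and> c j x = k. a' x) - (\<Sum>x | x \<in> X \<and> c j x = k. b' x)) 0" for k
      unfolding \<rho>_def by (rule cell_plan_row_rest[OF X I1(2,3)])
    have \<rho>6: "(\<Sum>y | y \<in> X \<and> c j y = k. b' y - (\<Sum>x\<in>X. \<rho> x y))
          = max ((\<Sum>x | x \<in> X \<and> c j x = k. b' x) - (\<Sum>x | x \<in> X \<and> c j x = k. a' x)) 0" for k
      unfolding \<rho>_def by (rule cell_plan_col_rest[OF X I1(2,3)])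
    have S: "(\<Sum>x | x \<in> X \<and> c j x = k. a' x) - (\<Sum>x | x \<in> X \<and> c j x = k. b' x) = S j k" for k
      unfolding S_def sum_subtractf[symmetric]
    proof (rule coarser_cell_sum_cong[OF X, of "c (Suc j)"])
      show "c j x = c j y" if "x \<in> X" "y \<in> X" "c (Suc j) x = c (Suc j) y" for x y
        using that by (rule nested[OF j(2)])
    next
      fix k assume "k \<in> c (Suc j) ` X"
      from I2[OF this] show "(\<Sum>x | x \<in> X \<and> c (Suc j) x = k. a' x - b' x)
          = (\<Sum>x | x \<in> X \<and> c (Suc j) x = k. a x - b x)"
        unfolding S_def[symmetric] sum_subtractf[of a' b'] by simp
    qed
    have moved: "(\<Sum>x\<in>X. \<Sum>y\<in>X. \<rho> x y) \<le> (\<Sum>k\<in>c (Suc j) ` X. \<bar>S (Suc j) k\<bar>) / 2"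
    proof -
      have "(\<Sum>x\<in>X. \<Sum>y\<in>X. \<rho> x y) \<le> sum a' X"
        by (intro sum_mono \<rho>3)
      moreover have "(\<Sum>x\<in>X. \<Sum>y\<in>X. \<rho> x y) \<le> sum b' X"
        by (subst sum.swap) (intro sum_mono \<rho>4)
      moreover have "sum a' X = (\<Sum>k\<in>c (Suc j) ` X. max (S (Suc j) k) 0)"
        by (subst sum.image_gen[OF X, of _ "c (Suc j)"]) (simp add: I2)
      moreover have "sum b' X = (\<Sum>k\<in>c (Suc j) ` X. max (- S (Suc j) k) 0)"
        by (subst sum.image_gen[OF X, of _ "c (Suc j)"]) (simp add: I2)
      moreover have "(\<Sum>k\<in>c (Suc j) ` X. max (S (Suc j) k) 0) + (\<Sum>k\<in>c (Suc j) ` X. max (- S (Suc j) k) 0)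
          = (\<Sum>k\<in>c (Suc j) ` X. \<bar>S (Suc j) k\<bar>)"
        by (subst sum.distrib[symmetric]) (rule sum.cong, auto)
      ultimately show ?thesis by linarith
    qed
    have "(\<Sum>x\<in>X. \<Sum>y\<in>X. d x y * \<rho> x y) \<le> (\<Sum>x\<in>X. \<Sum>y\<in>X. D j * \<rho> x y)"
    proof (intro sum_mono)
      fix x y assume "x \<in> X" "y \<in> X"
      then show "d x y * \<rho> x y \<le> D j * \<rho> x y"
        using \<rho>1[of x y] \<rho>2[of x y] diam[of j x y] j by (cases "c j x = c j y") (auto intro: mult_right_mono)
    qed
    also have "\<dots> = D j * (\<Sum>x\<in>X. \<Sum>y\<in>X. \<rho> x y)"
      by (simp add: sum_distrib_left)
    also have "\<dots> \<le> D j * ((\<Sum>k\<in>c (Suc j) ` X. \<bar>S (Suc j) k\<bar>) / 2)"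
      by (intro mult_left_mono moved D)
    finally have cost: "(\<Sum>x\<in>X. \<Sum>y\<in>X. d x y * (\<pi> x y + \<rho> x y))
        \<le> (\<Sum>i=j..<N. D i / 2 * (\<Sum>k\<in>c (Suc i) ` X. \<bar>S (Suc i) k\<bar>))"
      using I3 j by (simp add: distrib_left sum.distrib sum.atLeast_Suc_lessThan[of j N])
    have "inv j (\<lambda>x y. \<pi> x y + \<rho> x y) (\<lambda>x. a' x - (\<Sum>y\<in>X. \<rho> x y)) (\<lambda>y. b' y - (\<Sum>x\<in>X. \<rho> x y))"
      unfolding inv_def
    proof (intro conjI ballI)
      fix k
      show "(\<Sum>x | x \<in> X \<and> c j x = k. a' x - (\<Sum>y\<in>X. \<rho> x y)) = max (S j k) 0"
        unfolding \<rho>5 S by (rule refl)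
      show "(\<Sum>x | x \<in> X \<and> c j x = k. b' x - (\<Sum>y\<in>X. \<rho> y x)) = max (- S j k) 0"
        unfolding \<rho>6 S[of k, symmetric] by simp
      fix x assume x: "x \<in> X"
      show "(\<Sum>y\<in>X. \<pi> x y + \<rho> x y) + (a' x - (\<Sum>y\<in>X. \<rho> x y)) = a x"
        using I1(4)[OF x] by (simp add: sum.distrib)
      show "(\<Sum>y\<in>X. \<pi> y x + \<rho> y x) + (b' x - (\<Sum>y\<in>X. \<rho> y x)) = b x"
        using I1(5)[OF x] by (simp add: sum.distrib)
      show "0 \<le> a' x - (\<Sum>y\<in>X. \<rho> x y)" "0 \<le> b' x - (\<Sum>y\<in>X. \<rho> y x)"
        using \<rho>3[OF x] \<rho>4[OF x] by auto
      fix y assume y: "y \<in> X"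
      show "0 \<le> \<pi> x y + \<rho> x y"
        using I1(1)[OF x y] \<rho>1[OF x y] by simp
    qed (rule cost)
    then show "\<exists>\<pi> a' b'. inv j \<pi> a' b'" by blast
  qed simp
  then obtain \<pi> a' b' where I: "inv 0 \<pi> a' b'" by blast
  have S0: "S 0 (c 0 x) = 0" if "x \<in> X" for x
  proof -
    have "{y \<in> X. c 0 y = c 0 x} = X" using top[OF _ that] by blast
    then show ?thesis by (simp add: S_def sum_subtractf mass)
  qed
  have "a' x = 0 \<and> b' x = 0" if x: "x \<in> X" for x
  proof -
    have nonneg: "0 \<le> a' y" "0 \<le> b' y" if "y \<in> X" for y
      using I that by (auto simp: inv_def)
    have fin: "finite {y \<in> X. c 0 y = c 0 x}"
      using X by simp
    have "(\<Sum>y | y \<in> X \<and> c 0 y = c 0 x. a' y) = 0" "(\<Sum>y | y \<in> X \<and> c 0 y = c 0 x. b' y) = 0"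
      using I x S0[OF x] by (auto simp: inv_def)
    then show ?thesis
      using nonneg x by (subst (asm) (1 2) sum_nonneg_eq_0_iff[OF fin]) auto
  qed
  then show thesis
    using I by (intro that[of \<pi>]) (auto simp: inv_def S_def lessThan_atLeast0)
qed

text \<open>
  The value \<open>a x - b x\<close> is the net outflow of \<open>x\<close>, so all these absolute values together are at most twice
the mass that is moved off the diagonal, each unit of which costs at least \<open>\<delta>\<close>.
\<close>

lemma coupling_cost_ge:
  fixes a b :: "'x \<Rightarrow> real" and d \<pi> :: "'x \<Rightarrow> 'x \<Rightarrow> real"
  assumes X: "finite X"
    and pi: "\<And>x y. x \<in> X \<Longrightarrow> y \<in> X \<Longrightarrow> 0 \<le> \<pi> x y"
    and row: "\<And>x. x \<in> X \<Longrightarrow> (\<Sum>y\<in>X. \<pi> x y) = a x"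
    and col: "\<And>y. y \<in> X \<Longrightarrow> (\<Sum>x\<in>X. \<pi> x y) = b y"
    and diag: "\<And>x. x \<in> X \<Longrightarrow> 0 \<le> d x x"
    and sep: "\<And>x y. x \<in> X \<Longrightarrow> y \<in> X \<Longrightarrow> x \<noteq> y \<Longrightarrow> \<delta> \<le> d x y" and "0 \<le> \<delta>"
  shows "\<delta> * ((\<Sum>x\<in>X. \<bar>a x - b x\<bar>) / 2) \<le> (\<Sum>x\<in>X. \<Sum>y\<in>X. d x y * \<pi> x y)"
proof -
  define \<pi>' where "\<pi>' x y = (if x = y then 0 else \<pi> x y)" for x y
  have \<pi>'0: "0 \<le> \<pi>' x y" if "x \<in> X" "y \<in> X" for x y
    using pi that by (simp add: \<pi>'_def)
  have "\<bar>a x - b x\<bar> \<le> (\<Sum>y\<in>X. \<pi>' x y) + (\<Sum>y\<in>X. \<pi>' y x)" if x: "x \<in> X" for x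
  proof -
    have "a x - b x = (\<Sum>y\<in>X. \<pi> x y - \<pi> y x)"
      by (simp add: sum_subtractf row col x)
    also have "\<dots> = (\<Sum>y\<in>X. \<pi>' x y - \<pi>' y x)"
      by (rule sum.cong) (auto simp: \<pi>'_def)
    also have "\<bar>\<dots>\<bar> \<le> (\<Sum>y\<in>X. \<bar>\<pi>' x y - \<pi>' y x\<bar>)"
      by (rule sum_abs)
    also have "\<dots> \<le> (\<Sum>y\<in>X. \<pi>' x y + \<pi>' y x)"
    proof (rule sum_mono)
      fix y assume "y \<in> X"
      then show "\<bar>\<pi>' x y - \<pi>' y x\<bar> \<le> \<pi>' x y + \<pi>' y x"
        using \<pi>'0[of x y] \<pi>'0[of y x] x by auto
    qed
    finally show ?thesis by (simp add: sum.distrib)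
  qed
  then have "(\<Sum>x\<in>X. \<bar>a x - b x\<bar>) \<le> (\<Sum>x\<in>X. (\<Sum>y\<in>X. \<pi>' x y) + (\<Sum>y\<in>X. \<pi>' y x))"
    by (rule sum_mono)
  also have "\<dots> = 2 * (\<Sum>x\<in>X. \<Sum>y\<in>X. \<pi>' x y)"
    unfolding sum.distrib by (subst (2) sum.swap) simp
  finally have "\<delta> * ((\<Sum>x\<in>X. \<bar>a x - b x\<bar>) / 2) \<le> \<delta> * (\<Sum>x\<in>X. \<Sum>y\<in>X. \<pi>' x y)"
    using \<open>0 \<le> \<delta>\<close> by (intro mult_left_mono) auto
  also have "\<dots> = (\<Sum>x\<in>X. \<Sum>y\<in>X. \<delta> * \<pi>' x y)"
    by (simp add: sum_distrib_left)
  also have "\<dots> \<le> (\<Sum>x\<in>X. \<Sum>y\<in>X. d x y * \<pi> x y)"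
    by (intro sum_mono) (auto simp: \<pi>'_def intro!: mult_right_mono mult_nonneg_nonneg pi sep diag)
  finally show ?thesis .
qed

section \<open>Dyadic cells of the torus grid\<close>

lemma grid_eq_image: "grid n = (\<lambda>(i, j). (real i / real n, real j / real n)) ` ({..<n} \<times> {..<n})"
  unfolding grid_def by auto

lemma finite_grid [simp, intro]: "finite (grid n)"
  unfolding grid_eq_image by simp

lemma card_grid: "n > 0 \<Longrightarrow> card (grid n) = n\<^sup>2"
  unfolding grid_eq_image by (subst card_image) (auto simp: inj_on_def card_cartesian_product power2_eq_square)

lemma grid_unit:
  assumes "x \<in> grid n"
  shows "0 \<le> fst x" "fst x < 1" "0 \<le> snd x" "snd x < 1"
  using assms by (auto simp: grid_def)

lemma torus_dist_refl [simp]: "torus_dist x x = 0"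
  by (simp add: torus_dist_def)

lemma torus_dist_nonneg [simp]: "0 \<le> torus_dist x y"
  by (simp add: torus_dist_def)

lemma torus_dist_power2:
  "(torus_dist x y)\<^sup>2 = (min \<bar>fst x - fst y\<bar> (1 - \<bar>fst x - fst y\<bar>))\<^sup>2
                        + (min \<bar>snd x - snd y\<bar> (1 - \<bar>snd x - snd y\<bar>))\<^sup>2"
  by (simp add: torus_dist_def)

text \<open>
  On the torus, coordinates differ by at most \<open>1/2\<close>. The wrap-around matters for the constant: with the
diameter \<open>\<surd>2\<close> of the unit square, the coarsest level would contribute four times as much.
\<close>

lemma torus_dist_power2_le_half:
  assumes "x \<in> grid n" "y \<in> grid n"
  shows "(torus_dist x y)\<^sup>2 \<le> 1 / 2"
proof -
  have *: "(min \<bar>s - t\<bar> (1 - \<bar>s - t\<bar>))\<^sup>2 \<le> (1 / 2)\<^sup>2"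
    if "0 \<le> s" "s < 1" "0 \<le> t" "t < 1" for s t :: real
    using that by (intro power_mono) (auto simp: min_def abs_if)
  have "(torus_dist x y)\<^sup>2 \<le> (1 / 2)\<^sup>2 + (1 / 2)\<^sup>2"
    unfolding torus_dist_power2
    by (intro add_mono * grid_unit[OF assms(1)] grid_unit[OF assms(2)])
  then show ?thesis by (simp add: power2_eq_square)
qed

lemma torus_dist_power_le:
  assumes "x \<in> grid n" "y \<in> grid n" "2 \<le> p"
  shows "torus_dist x y ^ p \<le> (torus_dist x y)\<^sup>2"
proof -
  have "(torus_dist x y)\<^sup>2 \<le> 1\<^sup>2"
    using torus_dist_power2_le_half[OF assms(1,2)] by simp
  then have "torus_dist x y \<le> 1"
    by (rule power2_le_imp_le) simp
  then show ?thesis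
    using assms(3) by (intro power_decreasing) auto
qed

lemma torus_dist_separated:
  assumes "x \<in> grid n" "y \<in> grid n" "x \<noteq> y"
  shows "1 / real n \<le> torus_dist x y"
proof -
  have *: "1 / real n \<le> min \<bar>real i / real n - real j / real n\<bar> (1 - \<bar>real i / real n - real j / real n\<bar>)"
    if "i < n" "j < n" "i \<noteq> j" for i j :: nat
  proof -
    have "1 \<le> \<bar>real i - real j\<bar>" "\<bar>real i - real j\<bar> \<le> real n - 1"
      using that by linarith+
    then have "1 / real n \<le> \<bar>real i - real j\<bar> / real n" "\<bar>real i - real j\<bar> / real n \<le> 1 - 1 / real n"
      using that by (simp_all add: field_simps)
    then show ?thesis
      by (simp add: flip: diff_divide_distrib)
  qed
  have root: "r \<le> sqrt (r'\<^sup>2 + s\<^sup>2)" "r \<le> sqrt (s\<^sup>2 + r'\<^sup>2)" if "r \<le> r'" for r r' s :: real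
    using that by (smt (verit) real_sqrt_ge_abs1 real_sqrt_ge_abs2)+
  obtain i j k l where xy: "i < n" "j < n" "k < n" "l < n"
    "x = (real i / real n, real j / real n)" "y = (real k / real n, real l / real n)"
    using assms(1,2) by (auto simp: grid_def)
  show ?thesis
  proof (cases "i = k")
    case True
    then show ?thesis
      using xy assms(3) *[of j l] unfolding torus_dist_def xy fst_conv snd_conv
      by (intro root(2)) auto
  next
    case False
    then show ?thesis
      using xy *[of i k] unfolding torus_dist_def xy fst_conv snd_conv
      by (intro root(1)) auto
  qed
qed

definition dyadic_cell :: "nat \<Rightarrow> real \<times> real \<Rightarrow> int \<times> int" where
  "dyadic_cell j x = (\<lfloor>2 ^ j * fst x\<rfloor>, \<lfloor>2 ^ j * snd x\<rfloor>)"

lemma dyadic_cell_top: "x \<in> grid n \<Longrightarrow> dyadic_cell 0 x = (0, 0)"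
  using grid_unit[of x n] by (simp add: dyadic_cell_def floor_eq_iff)

text \<open>
  Halving and then rounding down gives the same result on a number and on its integer part, so the
index at level \<open>j\<close> is a function of the index at level \<open>j + 1\<close>.
\<close>

lemma dyadic_cell_nested:
  assumes "dyadic_cell (Suc j) x = dyadic_cell (Suc j) y"
  shows "dyadic_cell j x = dyadic_cell j y"
proof -
  have "\<lfloor>2 ^ j * s\<rfloor> = \<lfloor>2 ^ Suc j * s\<rfloor> div 2" for s :: real
  proof -
    have "\<lfloor>2 ^ j * s\<rfloor> = \<lfloor>2 ^ Suc j * s / real_of_int 2\<rfloor>" by simp
    also have "\<dots> = \<lfloor>2 ^ Suc j * s\<rfloor> div 2"
      by (rule floor_divide_real_eq_div) simp
    finally show ?thesis .
  qed
  then show ?thesis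
    using assms unfolding dyadic_cell_def by (metis prod.inject)
qed

lemma inj_on_dyadic_cell: "inj_on (dyadic_cell \<eta>) (grid (2 ^ \<eta>))"
  by (auto simp: inj_on_def dyadic_cell_def grid_def)

lemma card_dyadic_cells_le: "card (dyadic_cell j ` grid n) \<le> 4 ^ j"
proof -
  have *: "\<lfloor>2 ^ j * s\<rfloor> < 2 ^ j" if "s < 1" for s :: real
    using that by (simp add: floor_less_iff)
  have "dyadic_cell j ` grid n \<subseteq> {0..<2 ^ j} \<times> {0..<2 ^ j}"
  proof
    fix k assume "k \<in> dyadic_cell j ` grid n"
    then obtain x where "x \<in> grid n" "k = dyadic_cell j x" by blast
    then show "k \<in> {0..<2 ^ j} \<times> {0..<2 ^ j}"
      using grid_unit[of x n] *[of "fst x"] *[of "snd x"] by (simp add: dyadic_cell_def)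
  qed
  then have "card (dyadic_cell j ` grid n) \<le> card ({0..<2 ^ j :: int} \<times> {0..<2 ^ j :: int})"
    by (intro card_mono) auto
  also have "\<dots> = 2 ^ j * 2 ^ j"
    by (simp add: card_cartesian_product nat_power_eq)
  also have "\<dots> = 4 ^ j"
    by (simp flip: power_mult_distrib)
  finally show ?thesis .
qed

text \<open>
  An upper bound for squared distances within a cell of level \<open>j\<close>. The generic value \<open>2 / 4\<^sup>j\<close> is that of a
square of side \<open>2\<^sup>-\<^sup>j\<close>; the level \<open>0\<close> is the whole torus, for which \<open>1 / 2\<close> holds.
\<close>

definition cell_diam2 :: "nat \<Rightarrow> real" where
  "cell_diam2 j = (if j = 0 then 1 / 2 else 2 / 4 ^ j)"

lemma torus_dist_power_le_cell_diam2:
  assumes x: "x \<in> grid n" and y: "y \<in> grid n" and p: "2 \<le> p"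
    and cell: "dyadic_cell j x = dyadic_cell j y"
  shows "torus_dist x y ^ p \<le> cell_diam2 j"
proof -
  have near: "\<bar>s - t\<bar> \<le> 1 / 2 ^ j" if "\<lfloor>2 ^ j * s\<rfloor> = \<lfloor>2 ^ j * t\<rfloor>" for s t :: real
  proof -
    have "\<bar>2 ^ j * s - 2 ^ j * t\<bar> < 1"
      using that by linarith
    then have "2 ^ j * \<bar>s - t\<bar> < 1"
      by (simp add: abs_mult flip: right_diff_distrib)
    then show ?thesis
      by (simp add: field_simps)
  qed
  have sq: "(min \<bar>s - t\<bar> (1 - \<bar>s - t\<bar>))\<^sup>2 \<le> (1 / 2 ^ j)\<^sup>2"
    if "0 \<le> s" "s < 1" "0 \<le> t" "t < 1" "\<lfloor>2 ^ j * s\<rfloor> = \<lfloor>2 ^ j * t\<rfloor>" for s t :: real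
    using near[OF that(5)] that(1-4) by (intro power_mono) auto
  have "(torus_dist x y)\<^sup>2 \<le> (1 / 2 ^ j)\<^sup>2 + (1 / 2 ^ j)\<^sup>2"
    unfolding torus_dist_power2
    by (intro add_mono sq grid_unit[OF x] grid_unit[OF y]) (use cell in \<open>auto simp: dyadic_cell_def\<close>)
  also have "\<dots> = 2 / 4 ^ j"
    by (simp add: power_divide power2_eq_square flip: power_mult_distrib)
  finally have "(torus_dist x y)\<^sup>2 \<le> cell_diam2 j"
    using torus_dist_power2_le_half[OF x y] by (simp add: cell_diam2_def)
  then show ?thesis
    using torus_dist_power_le[OF x y p] by linarith
qed

text \<open>
  The weights \<open>2\<^sup>j\<^sup>+\<^sup>1\<close> are the growth of the expected discrepancies of level \<open>j + 1\<close>. Level \<open>0\<close> contributes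
\<open>1\<close>, and the other levels form a geometric series with sum below \<open>4\<close>.
\<close>

lemma sum_cell_diam2_le: "(\<Sum>j<N. cell_diam2 j * 2 ^ Suc j) \<le> 5"
proof -
  have "(\<Sum>j<Suc N. cell_diam2 j * 2 ^ Suc j) = 5 - 4 / 2 ^ N" for N
  proof (induction N)
    case 0
    show ?case by (simp add: cell_diam2_def)
  next
    case (Suc N)
    have "(4::real) ^ Suc N = 2 ^ Suc N * 2 ^ Suc N"
      by (simp flip: power_mult_distrib)
    then have "cell_diam2 (Suc N) * 2 ^ Suc (Suc N) = 4 / 2 ^ Suc N"
      by (simp add: cell_diam2_def field_simps)
    with Suc show ?case
      by (subst sum.lessThan_Suc) (simp add: field_simps)
  qed
  then show ?thesis
    by (cases N) (simp_all del: sum.lessThan_Suc)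
qed

section \<open>Bounds for the optimal transport cost on the grid\<close>

definition plan_cost :: "nat \<Rightarrow> nat \<Rightarrow> (real \<times> real \<Rightarrow> real \<times> real \<Rightarrow> real) \<Rightarrow> real" where
  "plan_cost n p \<pi> = (\<Sum>x\<in>grid n. \<Sum>y\<in>grid n. torus_dist x y ^ p * \<pi> x y)"

lemma plan_cost_nonneg:
  "(\<And>x y. x \<in> grid n \<Longrightarrow> y \<in> grid n \<Longrightarrow> 0 \<le> \<pi> x y) \<Longrightarrow> 0 \<le> plan_cost n p \<pi>"
  unfolding plan_cost_def by (intro sum_nonneg mult_nonneg_nonneg) auto

lemma bdd_below_plan_cost: "bdd_below (plan_cost n p ` couplings n \<alpha> \<beta>)"
  by (rule bdd_belowI[of _ 0]) (auto simp: couplings_def intro!: plan_cost_nonneg)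

lemma couplings_nonempty:
  assumes "\<And>x. x \<in> grid n \<Longrightarrow> 0 \<le> \<alpha> x" "\<And>x. x \<in> grid n \<Longrightarrow> 0 \<le> \<beta> x"
    and "sum \<alpha> (grid n) = sum \<beta> (grid n)"
  shows "couplings n \<alpha> \<beta> \<noteq> {}"
proof (rule subcoupling_completion[where X="grid n" and a=\<alpha> and b=\<beta> and q="\<lambda>_ _. 0"
      and d="\<lambda>_ _. 0" and K=0])
  fix \<pi>
  assume "\<And>x y. x \<in> grid n \<Longrightarrow> y \<in> grid n \<Longrightarrow> 0 \<le> \<pi> x y"
    "\<And>x. x \<in> grid n \<Longrightarrow> (\<Sum>y\<in>grid n. \<pi> x y) = \<alpha> x"
    "\<And>y. y \<in> grid n \<Longrightarrow> (\<Sum>x\<in>grid n. \<pi> x y) = \<beta> y"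
  then have "\<pi> \<in> couplings n \<alpha> \<beta>" by (simp add: couplings_def)
  then show ?thesis by blast
qed (simp_all add: assms)

lemma optimal_cost_le_multiscale:
  assumes a: "\<And>x. x \<in> grid n \<Longrightarrow> 0 \<le> \<alpha> x" and b: "\<And>x. x \<in> grid n \<Longrightarrow> 0 \<le> \<beta> x"
    and mass: "sum \<alpha> (grid n) = sum \<beta> (grid n)" and n: "n = 2 ^ \<eta>" and p: "2 \<le> p"
  shows "(INF \<pi>\<in>couplings n \<alpha> \<beta>. plan_cost n p \<pi>)
    \<le> (\<Sum>j<\<eta>. cell_diam2 j / 2 *
         (\<Sum>k\<in>dyadic_cell (Suc j) ` grid n. \<bar>\<Sum>x | x \<in> grid n \<and> dyadic_cell (Suc j) x = k. \<alpha> x - \<beta> x\<bar>))"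
proof (rule multiscale_coupling[where X="grid n" and a=\<alpha> and b=\<beta> and c=dyadic_cell and N=\<eta>
      and d="\<lambda>x y. torus_dist x y ^ p" and D=cell_diam2])
  show "finite (grid n)" "sum \<alpha> (grid n) = sum \<beta> (grid n)"
    by (fact finite_grid mass)+
  show "0 \<le> \<alpha> x" "0 \<le> \<beta> x" if "x \<in> grid n" for x
    using that by (fact a b)+
  show "inj_on (dyadic_cell \<eta>) (grid n)"
    unfolding n by (rule inj_on_dyadic_cell)
  show "torus_dist x x ^ p = 0" for x
    using p by simp
  show "0 \<le> cell_diam2 j" for j
    by (simp add: cell_diam2_def)
  fix x y assume xy: "x \<in> grid n" "y \<in> grid n"
  show "dyadic_cell 0 x = dyadic_cell 0 y"
    using xy by (simp add: dyadic_cell_top)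
  fix j
  show "dyadic_cell j x = dyadic_cell j y" if "dyadic_cell (Suc j) x = dyadic_cell (Suc j) y"
    using that by (rule dyadic_cell_nested)
  show "torus_dist x y ^ p \<le> cell_diam2 j" if "dyadic_cell j x = dyadic_cell j y"
    using xy p that by (rule torus_dist_power_le_cell_diam2)
next
  fix \<pi>
  assume \<pi>: "\<And>x y. x \<in> grid n \<Longrightarrow> y \<in> grid n \<Longrightarrow> 0 \<le> \<pi> x y"
    "\<And>x. x \<in> grid n \<Longrightarrow> (\<Sum>y\<in>grid n. \<pi> x y) = \<alpha> x"
    "\<And>y. y \<in> grid n \<Longrightarrow> (\<Sum>x\<in>grid n. \<pi> x y) = \<beta> y"
    and cost: "(\<Sum>x\<in>grid n. \<Sum>y\<in>grid n. torus_dist x y ^ p * \<pi> x y)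
     \<le> (\<Sum>j<\<eta>. cell_diam2 j / 2 *
         (\<Sum>k\<in>dyadic_cell (Suc j) ` grid n. \<bar>\<Sum>x | x \<in> grid n \<and> dyadic_cell (Suc j) x = k. \<alpha> x - \<beta> x\<bar>))"
  have "\<pi> \<in> couplings n \<alpha> \<beta>"
    using \<pi> by (simp add: couplings_def)
  from order_trans[OF cINF_lower[OF bdd_below_plan_cost this, of p] cost[folded plan_cost_def]]
  show ?thesis .
qed

lemma optimal_cost_ge:
  assumes "couplings n \<alpha> \<beta> \<noteq> {}" and p: "p > 0"
  shows "(1 / real n) ^ p * ((\<Sum>x\<in>grid n. \<bar>\<alpha> x - \<beta> x\<bar>) / 2)
    \<le> (INF \<pi>\<in>couplings n \<alpha> \<beta>. plan_cost n p \<pi>)"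
proof (rule cINF_greatest[OF assms(1)])
  fix \<pi> assume "\<pi> \<in> couplings n \<alpha> \<beta>"
  then show "(1 / real n) ^ p * ((\<Sum>x\<in>grid n. \<bar>\<alpha> x - \<beta> x\<bar>) / 2) \<le> plan_cost n p \<pi>"
    unfolding plan_cost_def couplings_def
    using p by (intro coupling_cost_ge[where d="\<lambda>x y. torus_dist x y ^ p"])
      (simp_all add: power_mono torus_dist_separated)
qed

section \<open>Measurability of the optimal transport cost\<close>

lemma rational_minorant:
  fixes r \<delta> :: real
  assumes "0 \<le> r" "0 < \<delta>"
  obtains s where "s \<in> \<rat>" "0 \<le> s" "s \<le> r" "r - \<delta> \<le> s"
proof (cases "r = 0")
  case True
  then show thesis using assms by (intro that[of 0]) auto
next
  case False
  then have "max 0 (r - \<delta>) < r" using assms by auto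
  from Rats_dense_in_real[OF this] obtain s where "s \<in> \<rat>" "max 0 (r - \<delta>) < s" "s < r" by blast
  then show thesis by (intro that[of s]) auto
qed

text \<open>
  Partial plans below the marginals, with the missing mass charged at the unit cost \<open>1\<close> (which bounds every
\<open>p\<close>-th power of a distance), have the same infimum of costs as couplings: completing such a plan costs
no more than the charge. Unlike couplings, partial plans may be perturbed downwards, so rational ones
suffice, and they range over a countable set that does not depend on the marginals.
\<close>

lemma optimal_cost_less_iff:
  fixes \<alpha> \<beta> :: "real \<times> real \<Rightarrow> real"
  assumes a: "\<And>x. x \<in> grid n \<Longrightarrow> 0 \<le> \<alpha> x" and b: "\<And>x. x \<in> grid n \<Longrightarrow> 0 \<le> \<beta> x"
    and mass: "sum \<alpha> (grid n) = sum \<beta> (grid n)"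
  shows "(INF \<pi>\<in>couplings n \<alpha> \<beta>. plan_cost n p \<pi>) < r \<longleftrightarrow>
    (\<exists>q\<in>(grid n \<times> grid n) \<rightarrow>\<^sub>E (\<rat> \<inter> {0..}).
       (\<forall>x\<in>grid n. (\<Sum>y\<in>grid n. q (x, y)) \<le> \<alpha> x) \<and>
       (\<forall>y\<in>grid n. (\<Sum>x\<in>grid n. q (x, y)) \<le> \<beta> y) \<and>
       plan_cost n p (curry q) + (sum \<alpha> (grid n) - (\<Sum>x\<in>grid n. \<Sum>y\<in>grid n. q (x, y))) < r)"
    (is "?V < r \<longleftrightarrow> (\<exists>q\<in>?R. ?P q)")
proof
  assume "?V < r"
  then obtain \<pi> where \<pi>: "\<pi> \<in> couplings n \<alpha> \<beta>" and less: "plan_cost n p \<pi> < r"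
    by (subst (asm) cINF_less_iff[OF couplings_nonempty[OF a b mass] bdd_below_plan_cost]) blast+
  have \<pi>0: "0 \<le> \<pi> x y" if "x \<in> grid n" "y \<in> grid n" for x y
    using \<pi> that by (simp add: couplings_def)
  have row: "(\<Sum>y\<in>grid n. \<pi> x y) = \<alpha> x" and col: "(\<Sum>y\<in>grid n. \<pi> y x) = \<beta> x" if "x \<in> grid n" for x
    using \<pi> that by (simp_all add: couplings_def)
  define m where "m = real (card (grid n))"
  \<comment> \<open>Rounding \<open>m\<^sup>2\<close> entries down by at most \<open>\<delta>\<close> each must cost less than \<open>r - plan_cost n p \<pi>\<close>.\<close>
  define \<delta> where "\<delta> = (r - plan_cost n p \<pi>) / (m * m + 1)"
  have m: "0 < m * m + 1"
    by (simp add: add_nonneg_pos)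
  then have \<delta>: "0 < \<delta>"
    using less by (simp add: \<delta>_def)
  have "\<forall>z\<in>grid n \<times> grid n. \<exists>s. s \<in> \<rat> \<and> 0 \<le> s \<and> s \<le> \<pi> (fst z) (snd z) \<and> \<pi> (fst z) (snd z) - \<delta> \<le> s"
    using \<pi>0 rational_minorant[OF _ \<delta>] by (metis mem_Times_iff)
  then obtain q0 where q0: "\<forall>z\<in>grid n \<times> grid n. q0 z \<in> \<rat> \<and> 0 \<le> q0 z \<and> q0 z \<le> \<pi> (fst z) (snd z)
      \<and> \<pi> (fst z) (snd z) - \<delta> \<le> q0 z"
    by metis
  define q where "q = restrict q0 (grid n \<times> grid n)"
  have q: "q (x, y) \<in> \<rat>" "0 \<le> q (x, y)" "q (x, y) \<le> \<pi> x y" "\<pi> x y - \<delta> \<le> q (x, y)"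
    if "x \<in> grid n" "y \<in> grid n" for x y
    using q0 that by (auto simp: q_def)
  have "q \<in> ?R"
    using q0 by (auto simp: q_def)
  moreover have "(\<Sum>y\<in>grid n. q (x, y)) \<le> \<alpha> x" if "x \<in> grid n" for x
    unfolding row[OF that, symmetric] using q that by (intro sum_mono) auto
  moreover have "(\<Sum>x\<in>grid n. q (x, y)) \<le> \<beta> y" if "y \<in> grid n" for y
    unfolding col[OF that, symmetric] using q that by (intro sum_mono) auto
  moreover have "plan_cost n p (curry q) + (sum \<alpha> (grid n) - (\<Sum>x\<in>grid n. \<Sum>y\<in>grid n. q (x, y))) < r"
  proof -
    have "plan_cost n p (curry q) \<le> plan_cost n p \<pi>"
      unfolding plan_cost_def using q by (intro sum_mono mult_left_mono) auto
    moreover have "sum \<alpha> (grid n) - (\<Sum>x\<in>grid n. \<Sum>y\<in>grid n. q (x, y))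
        = (\<Sum>x\<in>grid n. \<Sum>y\<in>grid n. \<pi> x y - q (x, y))"
      by (simp add: sum_subtractf row)
    moreover have "\<dots> \<le> (\<Sum>x\<in>grid n. \<Sum>y\<in>grid n. \<delta>)"
      using q(4) by (intro sum_mono) (simp add: algebra_simps)
    moreover have "(\<Sum>x\<in>grid n. \<Sum>y\<in>grid n. \<delta>) = m * m * \<delta>"
      by (simp add: m_def)
    moreover have "m * m * \<delta> < (m * m + 1) * \<delta>"
      using \<delta> by (simp add: algebra_simps)
    moreover have "(m * m + 1) * \<delta> = r - plan_cost n p \<pi>"
      using m by (simp add: \<delta>_def)
    ultimately show ?thesis by linarith
  qed
  ultimately show "\<exists>q\<in>?R. ?P q" by blast
next
  assume "\<exists>q\<in>?R. ?P q"
  then obtain q where q: "q \<in> ?R" and P: "?P q" by blast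
  have q0: "0 \<le> q (x, y)" if "x \<in> grid n" "y \<in> grid n" for x y
    using q that by (auto simp: PiE_iff)
  show "?V < r"
  proof (rule subcoupling_completion[where X="grid n" and a=\<alpha> and b=\<beta> and q="\<lambda>x y. q (x, y)"
        and d="\<lambda>x y. torus_dist x y ^ p" and K=1])
    show "torus_dist x y ^ p \<le> 1" if "x \<in> grid n" "y \<in> grid n" for x y
    proof (rule power_le_one)
      have "(torus_dist x y)\<^sup>2 \<le> 1\<^sup>2"
        using torus_dist_power2_le_half[OF that] by simp
      then show "torus_dist x y \<le> 1"
        by (rule power2_le_imp_le) simp
    qed simp
    fix \<pi>
    assume "\<And>x y. x \<in> grid n \<Longrightarrow> y \<in> grid n \<Longrightarrow> 0 \<le> \<pi> x y"
      "\<And>x. x \<in> grid n \<Longrightarrow> (\<Sum>y\<in>grid n. \<pi> x y) = \<alpha> x"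
      "\<And>y. y \<in> grid n \<Longrightarrow> (\<Sum>x\<in>grid n. \<pi> x y) = \<beta> y"
    then have \<pi>: "\<pi> \<in> couplings n \<alpha> \<beta>"
      by (simp add: couplings_def)
    assume "(\<Sum>x\<in>grid n. \<Sum>y\<in>grid n. torus_dist x y ^ p * \<pi> x y)
       \<le> (\<Sum>x\<in>grid n. \<Sum>y\<in>grid n. torus_dist x y ^ p * q (x, y))
         + 1 * (sum \<alpha> (grid n) - (\<Sum>x\<in>grid n. \<Sum>y\<in>grid n. q (x, y)))"
    then have "plan_cost n p \<pi> < r"
      using P by (simp add: plan_cost_def)
    with cINF_lower[OF bdd_below_plan_cost \<pi>] show "?V < r"
      by (rule le_less_trans)
  qed (use P q0 mass in simp_all)
qed

lemma couplings_empty: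
  assumes "sum \<alpha> (grid n) \<noteq> sum \<beta> (grid n)"
  shows "couplings n \<alpha> \<beta> = {}"
proof (rule ccontr)
  assume "couplings n \<alpha> \<beta> \<noteq> {}"
  then obtain \<pi> where \<pi>: "\<pi> \<in> couplings n \<alpha> \<beta>" by blast
  have "sum \<alpha> (grid n) = (\<Sum>x\<in>grid n. \<Sum>y\<in>grid n. \<pi> x y)"
    using \<pi> by (simp add: couplings_def)
  also have "\<dots> = (\<Sum>y\<in>grid n. \<Sum>x\<in>grid n. \<pi> x y)"
    by (rule sum.swap)
  also have "\<dots> = sum \<beta> (grid n)"
    using \<pi> by (simp add: couplings_def)
  finally show False using assms by contradiction
qed

text \<open>
  On the event that the masses agree, sublevel sets are countable unions by \<open>optimal_cost_less_iff\<close>. On its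
complement there is no coupling, and the infimum of the empty set is a constant.
\<close>

lemma measurable_optimal_cost:
  fixes \<alpha> \<beta> :: "'a \<Rightarrow> real \<times> real \<Rightarrow> real"
  assumes [measurable]: "\<And>x. x \<in> grid n \<Longrightarrow> (\<lambda>\<omega>. \<alpha> \<omega> x) \<in> borel_measurable M"
      "\<And>x. x \<in> grid n \<Longrightarrow> (\<lambda>\<omega>. \<beta> \<omega> x) \<in> borel_measurable M"
    and nonneg: "\<And>\<omega> x. x \<in> grid n \<Longrightarrow> 0 \<le> \<alpha> \<omega> x" "\<And>\<omega> x. x \<in> grid n \<Longrightarrow> 0 \<le> \<beta> \<omega> x"
  shows "(\<lambda>\<omega>. INF \<pi>\<in>couplings n (\<alpha> \<omega>) (\<beta> \<omega>). plan_cost n p \<pi>) \<in> borel_measurable M"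
proof (rule borel_measurableI_less)
  fix r :: real
  let ?R = "(grid n \<times> grid n) \<rightarrow>\<^sub>E (\<rat> \<inter> {0..} :: real set)"
  let ?E = "\<lambda>\<omega>. sum (\<alpha> \<omega>) (grid n) = sum (\<beta> \<omega>) (grid n)"
  let ?P = "\<lambda>q \<omega>. (\<forall>x\<in>grid n. (\<Sum>y\<in>grid n. q (x, y)) \<le> \<alpha> \<omega> x) \<and>
       (\<forall>y\<in>grid n. (\<Sum>x\<in>grid n. q (x, y)) \<le> \<beta> \<omega> y) \<and>
       plan_cost n p (curry q) + (sum (\<alpha> \<omega>) (grid n) - (\<Sum>x\<in>grid n. \<Sum>y\<in>grid n. q (x, y))) < r"
  have R: "countable ?R"
    by (intro countable_PiE countable_Int1 countable_rat) auto
  have P: "{\<omega> \<in> space M. ?P q \<omega>} \<in> sets M" for q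
    by measurable
  have U: "(\<Union>q\<in>?R. {\<omega> \<in> space M. ?P q \<omega>}) \<in> sets M"
    by (rule sets.countable_UN'[OF R]) (rule image_subsetI, rule P)
  have E: "{\<omega> \<in> space M. ?E \<omega>} \<in> sets M"
    by measurable
  have E': "{\<omega> \<in> space M. \<not> ?E \<omega> \<and> Inf {} < r} \<in> sets M"
    by measurable
  have "{\<omega> \<in> space M. (INF \<pi>\<in>couplings n (\<alpha> \<omega>) (\<beta> \<omega>). plan_cost n p \<pi>) < r}
      = ({\<omega> \<in> space M. ?E \<omega>} \<inter> (\<Union>q\<in>?R. {\<omega> \<in> space M. ?P q \<omega>}))
        \<union> {\<omega> \<in> space M. \<not> ?E \<omega> \<and> Inf {} < r}"
    (is "?L = ?Rhs")
  proof (rule set_eqI)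
    fix \<omega>
    show "\<omega> \<in> ?L \<longleftrightarrow> \<omega> \<in> ?Rhs"
    proof (cases "?E \<omega>")
      case True
      then show ?thesis
        using optimal_cost_less_iff[of n "\<alpha> \<omega>" "\<beta> \<omega>" p r, OF nonneg True] by blast
    next
      case False
      then show ?thesis
        by (simp add: couplings_empty)
    qed
  qed
  also have "\<dots> \<in> sets M"
    by (rule sets.Un[OF sets.Int[OF E U] E'])
  finally show "?L \<in> sets M" .
qed

section \<open>Convexity of powers\<close>

text \<open>
  A power lies above its tangents. Averaging this inequality with \<open>c\<close> the mean of \<open>w\<close> kills the linear term;
this proves both the power mean inequality and Jensen's inequality below.
\<close>

lemma tangent_le_power:
  fixes w c :: real
  assumes "0 \<le> w" "0 \<le> c" "2 \<le> p"
  shows "c ^ p + real p * c ^ (p - 1) * (w - c) \<le> w ^ p"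
proof (cases "c = 0")
  case True
  then show ?thesis using assms by (simp add: power_0_left)
next
  case False
  then have c: "c > 0" using assms by simp
  have "1 + real p * (w / c - 1) \<le> (1 + (w / c - 1)) ^ p"
    using c assms by (intro Bernoulli_inequality) simp
  then have "c ^ p * (1 + real p * (w / c - 1)) \<le> c ^ p * (w / c) ^ p"
    using c by (intro mult_left_mono) auto
  also have "\<dots> = w ^ p"
    using c by (simp flip: power_mult_distrib)
  also have "c ^ p = c * c ^ (p - 1)"
    using assms by (simp flip: power_Suc)
  then have "c ^ p * (1 + real p * (w / c - 1)) = c ^ p + real p * c ^ (p - 1) * (w - c)"
    using c by (simp add: field_simps)
  finally show ?thesis .
qed

lemma power_mean_le:
  fixes y :: "'x \<Rightarrow> real"
  assumes "finite X" "X \<noteq> {}" "\<And>x. x \<in> X \<Longrightarrow> 0 \<le> y x" "2 \<le> p"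
  shows "real (card X) * (sum y X / real (card X)) ^ p \<le> (\<Sum>x\<in>X. y x ^ p)"
proof -
  define c where "c = sum y X / real (card X)"
  have X: "real (card X) > 0" using assms(1,2) by (simp add: card_gt_0_iff)
  have c: "0 \<le> c" unfolding c_def using assms by (intro divide_nonneg_nonneg sum_nonneg) auto
  have "(\<Sum>x\<in>X. c ^ p + real p * c ^ (p - 1) * (y x - c)) \<le> (\<Sum>x\<in>X. y x ^ p)"
    using assms c by (intro sum_mono tangent_le_power) auto
  moreover have "(\<Sum>x\<in>X. y x - c) = 0"
    using X by (simp add: sum_subtractf c_def)
  ultimately show ?thesis
    unfolding c_def[symmetric] by (simp add: sum.distrib flip: sum_distrib_left)
qed

lemma (in prob_space) power_expectation_le:
  fixes Z :: "'a \<Rightarrow> real"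
  assumes "integrable M Z" "integrable M (\<lambda>\<omega>. Z \<omega> ^ p)" "\<And>\<omega>. 0 \<le> Z \<omega>" "2 \<le> p"
  shows "expectation Z ^ p \<le> expectation (\<lambda>\<omega>. Z \<omega> ^ p)"
proof -
  define c where "c = expectation Z"
  have c: "0 \<le> c" unfolding c_def using assms(3) by simp
  have "expectation (\<lambda>\<omega>. c ^ p + real p * c ^ (p - 1) * (Z \<omega> - c)) \<le> expectation (\<lambda>\<omega>. Z \<omega> ^ p)"
    using assms c by (intro integral_mono tangent_le_power) auto
  moreover have "expectation (\<lambda>\<omega>. c ^ p + real p * c ^ (p - 1) * (Z \<omega> - c)) = c ^ p"
    using assms(1) by (simp add: prob_space c_def)
  ultimately show ?thesis
    unfolding c_def by simp
qed

text \<open>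
  With \<open>y x = \<bar>f x\<bar> powr (1 / p)\<close>, the power mean inequality bounds \<open>\<Sum>\<bar>f x\<bar>\<close> from below by \<open>n\<^sup>2\<close> times the
\<open>p\<close>-th power of the mean of \<open>y\<close>, so that the \<open>p\<close>-th root can be taken explicitly.
\<close>

lemma root_cost_ge_mean_roots:
  fixes V :: real and f :: "'x \<Rightarrow> real"
  assumes X: "finite X" "card X = n\<^sup>2" and n: "n > 0" and p: "2 \<le> p"
    and V: "(1 / real n) ^ p * ((\<Sum>x\<in>X. \<bar>f x\<bar>) / 2) \<le> V"
  shows "real n powr (2 / real p - 1) * (1 / 2) powr (1 / real p)
      * ((\<Sum>x\<in>X. \<bar>f x\<bar> powr (1 / real p)) / (real n)\<^sup>2) \<le> V powr (1 / real p)"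
proof -
  define y where "y x = \<bar>f x\<bar> powr (1 / real p)" for x
  define c where "c = sum y X / (real n)\<^sup>2"
  have c: "0 \<le> c"
    unfolding c_def y_def by (intro divide_nonneg_nonneg sum_nonneg) auto
  have yp: "y x ^ p = \<bar>f x\<bar>" for x
    using p by (cases "f x = 0") (simp_all add: y_def powr_powr flip: powr_realpow)
  have "X \<noteq> {}" using X n by auto
  then have "(real n)\<^sup>2 * c ^ p \<le> (\<Sum>x\<in>X. y x ^ p)"
    using power_mean_le[OF X(1), of y p] X p by (simp add: c_def y_def)
  then have "(1 / real n) ^ p * ((real n)\<^sup>2 * c ^ p / 2) \<le> (1 / real n) ^ p * ((\<Sum>x\<in>X. \<bar>f x\<bar>) / 2)"
    unfolding yp by (intro mult_left_mono) auto
  also note V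
  finally have "((1 / real n) ^ p * ((real n)\<^sup>2 * c ^ p / 2)) powr (1 / real p) \<le> V powr (1 / real p)"
    using c by (intro powr_mono2) auto
  moreover have "((1 / real n) ^ p * ((real n)\<^sup>2 * c ^ p / 2)) powr (1 / real p)
      = real n powr (2 / real p - 1) * (1 / 2) powr (1 / real p) * c"
  proof -
    have root: "(t ^ p) powr (1 / real p) = t" if "0 \<le> t" for t :: real
      using that p by (cases "t = 0") (simp_all add: powr_powr flip: powr_realpow)
    have "((1 / real n) ^ p * ((real n)\<^sup>2 * c ^ p / 2)) powr (1 / real p)
        = ((1 / real n) ^ p) powr (1 / real p) * (((real n)\<^sup>2) powr (1 / real p)
            * ((c ^ p) powr (1 / real p) * (1 / 2) powr (1 / real p)))"
      using c by (simp add: powr_mult[symmetric])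
    also have "\<dots> = (1 / real n) * (real n powr (2 / real p) * (c * (1 / 2) powr (1 / real p)))"
      using c n by (simp add: root powr_powr flip: powr_numeral)
    also have "\<dots> = real n powr (2 / real p - 1) * (1 / 2) powr (1 / real p) * c"
      using n by (simp add: powr_diff)
    finally show ?thesis .
  qed
  ultimately show ?thesis
    by (simp add: c_def y_def)
qed

section \<open>Absolute moments of the normal law\<close>

text \<open>
  The substitution \<open>t = z\<^sup>2 / 2\<close> turns the half-line integral of \<open>\<bar>z\<bar>\<^sup>s exp (- z\<^sup>2 / 2)\<close> into Euler's integral for
\<open>Gamma ((s + 1) / 2)\<close>, and the integrand is even.
\<close>

lemma std_normal_abs_moment:
  assumes s: "s > -1"
  shows "integrable std_normal_distribution (\<lambda>z. \<bar>z\<bar> powr s)" (is ?int)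
    and "(\<integral>z. \<bar>z\<bar> powr s \<partial>std_normal_distribution) = 2 powr (s / 2) * Gamma ((s + 1) / 2) / sqrt pi" (is ?eq)
proof -
  define x where "x = (s + 1) / 2"
  have x: "x > 0" using s by (simp add: x_def)
  let ?f = "\<lambda>t::real. t powr (x - 1) / exp t"
  let ?g = "\<lambda>z::real. z\<^sup>2 / 2"
  let ?h = "\<lambda>z::real. std_normal_density z * \<bar>z\<bar> powr s"
  have "(?f has_integral Gamma x) {0<..} \<longleftrightarrow> (?f has_integral Gamma x) {0..}"
    by (rule has_integral_spike_set_eq; rule negligible_subset[of "{0}"]) auto
  then have gamma: "(?f has_integral Gamma x) {0<..}"
    using Gamma_integral_real[OF x] by simp
  have gamma_abs: "?f absolutely_integrable_on {0<..}"
    using gamma by (intro nonnegative_absolutely_integrable_1) auto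
  have img: "?g ` {0<..} = {0<..}"
  proof (intro equalityI subsetI)
    fix t :: real assume "t \<in> {0<..}"
    then show "t \<in> ?g ` {0<..}"
      by (intro image_eqI[of _ _ "sqrt (2 * t)"]) auto
  qed auto
  have inj: "inj_on ?g {0<..}"
    by (auto simp: inj_on_def power2_eq_iff)
  have chg: "(\<lambda>z. \<bar>z\<bar> * ?f (?g z)) absolutely_integrable_on {0<..} \<and>
        integral {0<..} (\<lambda>z. \<bar>z\<bar> * ?f (?g z)) = Gamma x"
    using gamma_abs integral_unique[OF gamma]
    by (subst has_absolute_integral_change_of_variables_1'[OF _ _ inj])
       (auto intro!: derivative_eq_intros simp: img)
  have sub: "((\<lambda>z. \<bar>z\<bar> * ?f (?g z)) has_integral Gamma x) {0<..}"
    using integrable_integral[OF set_lebesgue_integral_eq_integral(1)[OF conjunct1[OF chg]]]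
    unfolding conjunct2[OF chg] .
  define C where "C = 2 powr (x - 1) / sqrt (2 * pi)"
  have h_eq: "?h z = C * (\<bar>z\<bar> * ?f (?g z))" if "z \<in> {0<..}" for z :: real
  proof -
    have z: "z > 0" using that by simp
    have "(z\<^sup>2 / 2) powr (x - 1) = (z powr 2) powr (x - 1) / 2 powr (x - 1)"
      using z by (simp add: powr_divide powr_numeral)
    also have "(z powr 2) powr (x - 1) = z powr (s - 1)"
    proof -
      have "2 * (x - 1) = s - 1" by (simp add: x_def)
      then show ?thesis by (simp only: powr_powr)
    qed
    finally have "z * (z\<^sup>2 / 2) powr (x - 1) = z powr s / 2 powr (x - 1)"
      using z by (simp add: powr_diff)
    then show ?thesis
      using z by (simp add: C_def normal_density_def exp_minus field_simps)
  qed
  have half: "(?h has_integral C * Gamma x) {0<..}"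
    using has_integral_mult_right[OF sub, of C] by (rule has_integral_eq[rotated]) (rule h_eq[symmetric])
  have "(\<integral>\<^sup>+z. indicator {0<..} z * ?h z \<partial>lborel) = ennreal (C * Gamma x)"
    by (rule nn_integral_has_integral_lebesgue[OF _ half]) simp
  then have "has_bochner_integral lborel (\<lambda>z. indicator {0<..} z * ?h z) (C * Gamma x)"
    using x by (intro has_bochner_integral_nn_integral) (auto simp: C_def Gamma_real_pos less_imp_le)
  then have "has_bochner_integral lborel (\<lambda>z. indicator {0..} z *\<^sub>R ?h z) (C * Gamma x)"
    by (rule has_bochner_integral_cong[THEN iffD1, rotated -1]) (auto simp: indicator_def)
  then have "has_bochner_integral lborel ?h (2 *\<^sub>R (C * Gamma x))"
    by (rule has_bochner_integral_even_function) (simp add: normal_density_def)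
  moreover have "2 * C = 2 powr (s / 2) / sqrt pi"
  proof -
    have "2 powr (s / 2) = 2 powr (x - 1) * 2 powr (1 / 2 :: real)"
      by (subst powr_add[symmetric]) (simp add: x_def field_simps)
    then have "2 powr (s / 2) = 2 powr (x - 1) * sqrt 2"
      by (simp add: powr_half_sqrt)
    then show ?thesis
      by (simp add: C_def real_sqrt_mult field_simps)
  qed
  ultimately have "has_bochner_integral lborel ?h (2 powr (s / 2) * Gamma x / sqrt pi)"
    by (simp add: mult.assoc[symmetric])
  then show ?int ?eq
    by (simp_all add: has_bochner_integral_iff integrable_density integral_density x_def)
qed

section \<open>The noise difference\<close>

text \<open>
  Describing the law as that of a scaled standard normal variable, instead of by a density, includes the
degenerate case \<open>v = 0\<close>, which the total noise needs.
\<close>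

lemma (in prob_space) normal_distr_unique:
  assumes Y: "Y \<in> borel_measurable M" and v: "v \<ge> 0"
    and char: "\<And>t. char (distr M borel Y) t = exp (- of_real (v * t\<^sup>2) / 2)"
  shows "distr M borel Y = distr std_normal_distribution borel (\<lambda>z. sqrt v * z)"
proof (rule Levy_uniqueness)
  interpret N: real_distribution std_normal_distribution
    by (rule real_dist_normal_dist)
  show "real_distribution (distr M borel Y)"
    using Y by (rule real_distribution_distr)
  show "real_distribution (distr std_normal_distribution borel (\<lambda>z. sqrt v * z))"
    by (rule N.real_distribution_distr) simp
  show "char (distr M borel Y) = char (distr std_normal_distribution borel (\<lambda>z. sqrt v * z))"
  proof
    fix t
    have "char (distr std_normal_distribution borel (\<lambda>z. sqrt v * z)) t
        = char std_normal_distribution (t * sqrt v)"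
      unfolding char_def by (subst integral_distr) (simp_all add: mult.assoc)
    moreover have "(complex_of_real (sqrt v))\<^sup>2 = of_real v"
      using v by (metis of_real_power real_sqrt_pow2)
    ultimately show "char (distr M borel Y) t = char (distr std_normal_distribution borel (\<lambda>z. sqrt v * z)) t"
      unfolding char using v
      by (simp add: char_std_normal_distribution power_mult_distrib mult.commute flip: exp_of_real)
  qed
qed

lemma sum_noise_cov:
  assumes "finite Q"
  shows "(\<Sum>x\<in>Q. \<Sum>y\<in>Q. noise_cov n \<sigma> x y)
    = \<sigma>\<^sup>2 * real (card Q) - \<sigma>\<^sup>2 * real (card Q) * (real (card Q) - 1) / (real (n\<^sup>2) - 1)"
proof -
  have "(\<Sum>y\<in>Q. noise_cov n \<sigma> x y) = \<sigma>\<^sup>2 - \<sigma>\<^sup>2 * (real (card Q) - 1) / (real (n\<^sup>2) - 1)"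
    if x: "x \<in> Q" for x
  proof -
    have "(\<Sum>y\<in>Q - {x}. noise_cov n \<sigma> x y) = (\<Sum>y\<in>Q - {x}. - \<sigma>\<^sup>2 / (real (n\<^sup>2) - 1))"
      by (rule sum.cong) (auto simp: noise_cov_def)
    also have "\<dots> = - \<sigma>\<^sup>2 * (real (card Q) - 1) / (real (n\<^sup>2) - 1)"
      using x assms card_gt_0_iff[of Q] by (auto simp: of_nat_diff)
    finally show ?thesis
      using x assms by (simp add: sum.remove[of Q x] noise_cov_def)
  qed
  then have "(\<Sum>x\<in>Q. \<Sum>y\<in>Q. noise_cov n \<sigma> x y)
      = (\<Sum>x\<in>Q. \<sigma>\<^sup>2 - \<sigma>\<^sup>2 * (real (card Q) - 1) / (real (n\<^sup>2) - 1))"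
    by (rule sum.cong[OF refl])
  then show ?thesis
    by (simp add: right_diff_distrib mult_ac)
qed

lemma (in prob_space) char_noise_sum:
  assumes noise: "zero_sum_gaussian_noise M n \<sigma> \<epsilon>" and Q: "Q \<subseteq> grid n"
  shows "char (distr M borel (\<lambda>\<omega>. \<Sum>x\<in>Q. \<epsilon> \<omega> x)) t
    = exp (- of_real (t\<^sup>2 * (\<Sum>x\<in>Q. \<Sum>y\<in>Q. noise_cov n \<sigma> x y)) / 2)"
proof -
  have meas: "(\<lambda>\<omega>. \<epsilon> \<omega> x) \<in> borel_measurable M" if "x \<in> Q" for x
    using noise Q that by (auto simp: zero_sum_gaussian_noise_def gaussian_vector_def)
  define u where "u x = (if x \<in> Q then t else 0)" for x
  have lin: "(\<Sum>x\<in>grid n. u x * f x) = t * (\<Sum>x\<in>Q. f x)" for f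
  proof -
    have "(\<Sum>x\<in>grid n. u x * f x) = (\<Sum>x\<in>Q. t * f x)"
      by (rule sum.mono_neutral_cong_right) (use Q finite_grid in \<open>auto simp: u_def\<close>)
    then show ?thesis by (simp add: sum_distrib_left)
  qed
  have quad: "(\<Sum>x\<in>grid n. \<Sum>y\<in>grid n. u x * noise_cov n \<sigma> x y * u y)
      = t\<^sup>2 * (\<Sum>x\<in>Q. \<Sum>y\<in>Q. noise_cov n \<sigma> x y)"
  proof -
    have "(\<Sum>x\<in>grid n. \<Sum>y\<in>grid n. u x * noise_cov n \<sigma> x y * u y)
        = (\<Sum>x\<in>grid n. u x * (\<Sum>y\<in>grid n. u y * noise_cov n \<sigma> x y))"
      by (simp add: sum_distrib_left mult_ac)
    then show ?thesis
      unfolding lin by (simp add: power2_eq_square sum_distrib_left mult.assoc)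
  qed
  have "char (distr M borel (\<lambda>\<omega>. \<Sum>x\<in>Q. \<epsilon> \<omega> x)) t = (CLINT \<omega>|M. iexp (\<Sum>x\<in>grid n. u x * \<epsilon> \<omega> x))"
    unfolding char_def lin by (subst integral_distr) (use meas in auto)
  also have "\<dots> = exp (\<i> * of_real (\<Sum>x\<in>grid n. u x * 0)
       - of_real (\<Sum>x\<in>grid n. \<Sum>y\<in>grid n. u x * noise_cov n \<sigma> x y * u y) / 2)"
    using noise unfolding zero_sum_gaussian_noise_def gaussian_vector_def by blast
  finally show ?thesis
    unfolding quad by simp
qed

text \<open>
  By independence the characteristic functions of the two block sums multiply; they are equal and even,
so the variances add up to twice that of a single noise block.
\<close>

lemma (in prob_space) distr_noise_difference:
  assumes noise: "zero_sum_gaussian_noise M n \<sigma> \<epsilon>1" "zero_sum_gaussian_noise M n \<sigma> \<epsilon>2"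
    and indep: "indep_var (\<Pi>\<^sub>M x\<in>grid n. borel) (\<lambda>\<omega>. restrict (\<epsilon>1 \<omega>) (grid n))
                          (\<Pi>\<^sub>M x\<in>grid n. borel) (\<lambda>\<omega>. restrict (\<epsilon>2 \<omega>) (grid n))"
    and Q: "Q \<subseteq> grid n"
    and v: "0 \<le> (\<Sum>x\<in>Q. \<Sum>y\<in>Q. noise_cov n \<sigma> x y)"
  shows "distr M borel (\<lambda>\<omega>. \<Sum>x\<in>Q. \<epsilon>1 \<omega> x - \<epsilon>2 \<omega> x)
    = distr std_normal_distribution borel (\<lambda>z. sqrt (2 * (\<Sum>x\<in>Q. \<Sum>y\<in>Q. noise_cov n \<sigma> x y)) * z)"
proof (rule normal_distr_unique)
  have meas [measurable]: "(\<lambda>\<omega>. \<epsilon>1 \<omega> x) \<in> borel_measurable M" "(\<lambda>\<omega>. \<epsilon>2 \<omega> x) \<in> borel_measurable M"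
    if "x \<in> Q" for x
    using noise Q that by (auto simp: zero_sum_gaussian_noise_def gaussian_vector_def)
  show "(\<lambda>\<omega>. \<Sum>x\<in>Q. \<epsilon>1 \<omega> x - \<epsilon>2 \<omega> x) \<in> borel_measurable M"
    by measurable
  fix t
  let ?v = "\<Sum>x\<in>Q. \<Sum>y\<in>Q. noise_cov n \<sigma> x y"
  let ?S = "\<lambda>f. \<Sum>x\<in>Q. f x :: real"
  have comp: "(\<lambda>f. f x) \<in> (\<Pi>\<^sub>M x\<in>grid n. borel) \<rightarrow>\<^sub>M (borel :: real measure)" if "x \<in> Q" for x
    using Q that by (intro measurable_component_singleton) auto
  have S: "?S \<in> (\<Pi>\<^sub>M x\<in>grid n. borel) \<rightarrow>\<^sub>M borel" "(\<lambda>f. - ?S f) \<in> (\<Pi>\<^sub>M x\<in>grid n. borel) \<rightarrow>\<^sub>M borel"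
    by (intro borel_measurable_sum borel_measurable_uminus comp; assumption)+
  have restr: "?S (restrict (\<epsilon> \<omega>) (grid n)) = ?S (\<epsilon> \<omega>)" for \<epsilon> and \<omega> :: 'a
    by (rule sum.cong) (use Q in auto)
  have "indep_var borel (\<lambda>\<omega>. ?S (\<epsilon>1 \<omega>)) borel (\<lambda>\<omega>. - ?S (\<epsilon>2 \<omega>))"
    using indep_var_compose[OF indep S] unfolding comp_def restr .
  from char_distr_add[OF this, of t]
  have "char (distr M borel (\<lambda>\<omega>. \<Sum>x\<in>Q. \<epsilon>1 \<omega> x - \<epsilon>2 \<omega> x)) t
      = char (distr M borel (\<lambda>\<omega>. ?S (\<epsilon>1 \<omega>))) t * char (distr M borel (\<lambda>\<omega>. - ?S (\<epsilon>2 \<omega>))) t"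
    by (simp add: sum_subtractf)
  also have "char (distr M borel (\<lambda>\<omega>. - ?S (\<epsilon>2 \<omega>))) t = char (distr M borel (\<lambda>\<omega>. ?S (\<epsilon>2 \<omega>))) (- t)"
    unfolding char_def by (subst (1 2) integral_distr) auto
  finally show "char (distr M borel (\<lambda>\<omega>. \<Sum>x\<in>Q. \<epsilon>1 \<omega> x - \<epsilon>2 \<omega> x)) t
      = exp (- of_real (2 * ?v * t\<^sup>2) / 2)"
    unfolding char_noise_sum[OF noise(1) Q] char_noise_sum[OF noise(2) Q]
    by (simp add: mult_exp_exp mult_ac)
qed (use v in simp)

text \<open>
  The setting of the theorem without the image \<open>\<mu>\<close>, which cancels in the difference of the two noisy images.
\<close>

locale noise_pair = prob_space M for M :: "'a measure" +
  fixes n :: nat and \<sigma> :: real and \<epsilon>1 \<epsilon>2 :: "'a \<Rightarrow> real \<times> real \<Rightarrow> real"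
  assumes n2: "2 \<le> n" and sigma: "0 < \<sigma>"
    and noise1: "zero_sum_gaussian_noise M n \<sigma> \<epsilon>1"
    and noise2: "zero_sum_gaussian_noise M n \<sigma> \<epsilon>2"
    and indep: "indep_var (\<Pi>\<^sub>M x\<in>grid n. borel) (\<lambda>\<omega>. restrict (\<epsilon>1 \<omega>) (grid n))
                          (\<Pi>\<^sub>M x\<in>grid n. borel) (\<lambda>\<omega>. restrict (\<epsilon>2 \<omega>) (grid n))"
begin

definition noise_diff :: "'a \<Rightarrow> (real \<times> real) set \<Rightarrow> real" where
  "noise_diff \<omega> Q = (\<Sum>x\<in>Q. \<epsilon>1 \<omega> x - \<epsilon>2 \<omega> x)"

definition block_var :: "(real \<times> real) set \<Rightarrow> real" where
  "block_var Q = (\<Sum>x\<in>Q. \<Sum>y\<in>Q. noise_cov n \<sigma> x y)"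

lemma measurable_noise [measurable]:
  "x \<in> grid n \<Longrightarrow> (\<lambda>\<omega>. \<epsilon>1 \<omega> x) \<in> borel_measurable M"
  "x \<in> grid n \<Longrightarrow> (\<lambda>\<omega>. \<epsilon>2 \<omega> x) \<in> borel_measurable M"
  using noise1 noise2 by (auto simp: zero_sum_gaussian_noise_def gaussian_vector_def)

lemma measurable_block: "Q \<subseteq> grid n \<Longrightarrow> (\<lambda>\<omega>. noise_diff \<omega> Q) \<in> borel_measurable M"
  unfolding noise_diff_def by (intro borel_measurable_sum borel_measurable_diff measurable_noise) auto

text \<open>
  Distinct pixels are negatively correlated, so a block of \<open>N\<close> pixels has at most the variance of \<open>N\<close>
independent ones. Nonnegativity is the estimate \<open>N \<le> n\<^sup>2\<close>, with equality for the whole grid.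
\<close>

lemma block_var_bounds:
  assumes Q: "Q \<subseteq> grid n"
  shows "0 \<le> block_var Q" "block_var Q \<le> \<sigma>\<^sup>2 * real (card Q)"
proof -
  have fin: "finite Q"
    using Q finite_grid by (rule finite_subset)
  define N where "N = real (card Q)"
  define m where "m = real (n\<^sup>2)"
  have "card Q \<le> n\<^sup>2"
    using card_mono[OF finite_grid Q] n2 by (simp add: card_grid)
  then have Nm: "N \<le> m"
    unfolding N_def m_def by (rule of_nat_mono)
  have "2 * 2 \<le> n * n"
    using n2 by (intro mult_mono) auto
  then have "real 4 \<le> m"
    unfolding m_def by (intro of_nat_mono) (simp add: power2_eq_square)
  then have m: "1 < m" by simp
  have N: "N = 0 \<or> 1 \<le> N"
    unfolding N_def by (cases "card Q") auto
  have eq: "block_var Q = \<sigma>\<^sup>2 * N - \<sigma>\<^sup>2 * N * ((N - 1) / (m - 1))"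
    unfolding block_var_def sum_noise_cov[OF fin] N_def m_def by simp
  have ratio: "(N - 1) / (m - 1) \<le> 1"
    using Nm m by simp
  have "\<sigma>\<^sup>2 * N * ((N - 1) / (m - 1)) \<le> \<sigma>\<^sup>2 * N"
    by (rule mult_left_le[OF ratio]) (simp add: N_def)
  then show "0 \<le> block_var Q"
    unfolding eq by simp
  have "0 \<le> \<sigma>\<^sup>2 * N * ((N - 1) / (m - 1))"
    using N m by (elim disjE) simp_all
  then show "block_var Q \<le> \<sigma>\<^sup>2 * real (card Q)"
    unfolding eq N_def by simp
qed

lemma block_var_singleton: "block_var {x} = \<sigma>\<^sup>2"
  by (simp add: block_var_def noise_cov_def)

lemma block_var_grid: "block_var (grid n) = 0"
proof -
  have "n\<^sup>2 \<noteq> 1"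
    using n2 by (simp add: power2_eq_square)
  then have "real (n\<^sup>2) \<noteq> 1"
    by (simp only: of_nat_eq_1_iff not_False_eq_True)
  then show ?thesis
    unfolding block_var_def sum_noise_cov[OF finite_grid] using n2 by (simp add: card_grid)
qed

lemma block_distr:
  assumes Q: "Q \<subseteq> grid n"
  shows "distr M borel (\<lambda>\<omega>. noise_diff \<omega> Q)
    = distr std_normal_distribution borel (\<lambda>z. sqrt (2 * block_var Q) * z)"
  unfolding noise_diff_def block_var_def
  by (rule distr_noise_difference[OF noise1 noise2 indep Q])
     (use block_var_bounds(1)[OF Q] in \<open>simp add: block_var_def\<close>)

lemma block_abs_moment:
  assumes Q: "Q \<subseteq> grid n" and s: "0 < s"
  shows "integrable M (\<lambda>\<omega>. \<bar>noise_diff \<omega> Q\<bar> powr s)"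
    and "expectation (\<lambda>\<omega>. \<bar>noise_diff \<omega> Q\<bar> powr s) = (2 * sqrt (block_var Q)) powr s * Gamma ((s + 1) / 2) / sqrt pi"
proof -
  let ?c = "sqrt (2 * block_var Q)"
  let ?G = "\<lambda>y::real. \<bar>y\<bar> powr s"
  have c: "0 \<le> ?c" using block_var_bounds(1)[OF Q] by simp
  have scale: "?G (?c * z) = ?c powr s * ?G z" for z
    using c by (simp add: abs_mult powr_mult)
  have "integrable std_normal_distribution (\<lambda>z. ?G (?c * z))"
    unfolding scale using std_normal_abs_moment(1)[of s] s by simp
  then have "integrable (distr std_normal_distribution borel (\<lambda>z. ?c * z)) ?G"
    by (subst integrable_distr_eq) simp_all
  then show "integrable M (\<lambda>\<omega>. \<bar>noise_diff \<omega> Q\<bar> powr s)"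
    unfolding block_distr[OF Q, symmetric]
    by (subst (asm) integrable_distr_eq) (use measurable_block[OF Q] in simp_all)
  have "expectation (\<lambda>\<omega>. ?G (noise_diff \<omega> Q)) = integral\<^sup>L (distr M borel (\<lambda>\<omega>. noise_diff \<omega> Q)) ?G"
    by (subst integral_distr) (use measurable_block[OF Q] in simp_all)
  also have "\<dots> = (\<integral>z. ?G (?c * z) \<partial>std_normal_distribution)"
    unfolding block_distr[OF Q] by (subst integral_distr) simp_all
  also have "\<dots> = ?c powr s * (2 powr (s / 2) * Gamma ((s + 1) / 2) / sqrt pi)"
    unfolding scale using std_normal_abs_moment(2)[of s] s by simp
  \<comment> \<open>The two factors \<open>\<surd>2\<close>, from the doubled variance and from the moment, combine to \<open>2\<close>.\<close>
  also have "?c powr s * 2 powr (s / 2) = (2 * sqrt (block_var Q)) powr s"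
  proof -
    have "2 powr (s / 2) = sqrt 2 powr s"
      by (simp add: powr_half_sqrt[symmetric] powr_powr)
    moreover have "?c * sqrt 2 = 2 * sqrt (block_var Q)"
      by (simp add: real_sqrt_mult)
    ultimately show ?thesis
      using c by (simp add: powr_mult[symmetric])
  qed
  then have "?c powr s * (2 powr (s / 2) * Gamma ((s + 1) / 2) / sqrt pi)
      = (2 * sqrt (block_var Q)) powr s * Gamma ((s + 1) / 2) / sqrt pi"
    by (simp add: mult.assoc[symmetric])
  finally show "expectation (\<lambda>\<omega>. \<bar>noise_diff \<omega> Q\<bar> powr s)
      = (2 * sqrt (block_var Q)) powr s * Gamma ((s + 1) / 2) / sqrt pi" .
qed

lemma block_abs_expectation:
  assumes Q: "Q \<subseteq> grid n"
  shows "integrable M (\<lambda>\<omega>. \<bar>noise_diff \<omega> Q\<bar>)"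
    and "expectation (\<lambda>\<omega>. \<bar>noise_diff \<omega> Q\<bar>) \<le> 2 * \<sigma> / sqrt pi * sqrt (card Q)"
proof -
  show "integrable M (\<lambda>\<omega>. \<bar>noise_diff \<omega> Q\<bar>)"
    using block_abs_moment(1)[OF Q, of 1] by simp
  have "expectation (\<lambda>\<omega>. \<bar>noise_diff \<omega> Q\<bar>) = 2 / sqrt pi * sqrt (block_var Q)"
    using block_abs_moment(2)[OF Q, of 1] block_var_bounds(1)[OF Q] by simp
  also have "\<dots> \<le> 2 / sqrt pi * sqrt (\<sigma>\<^sup>2 * real (card Q))"
    by (intro mult_left_mono real_sqrt_le_mono block_var_bounds Q) simp
  also have "sqrt (\<sigma>\<^sup>2 * real (card Q)) = \<sigma> * sqrt (card Q)"
    using sigma by (simp add: real_sqrt_mult)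
  finally show "expectation (\<lambda>\<omega>. \<bar>noise_diff \<omega> Q\<bar>) \<le> 2 * \<sigma> / sqrt pi * sqrt (card Q)"
    by simp
qed

text \<open>
  The total noise has variance zero. Almost surely, therefore, the two measures to be compared have equal
mass, which is exactly what the existence of a coupling needs.
\<close>

lemma AE_total_zero: "AE \<omega> in M. noise_diff \<omega> (grid n) = 0"
proof -
  have "AE y in distr std_normal_distribution borel (\<lambda>z. sqrt (2 * block_var (grid n)) * z). y = 0"
    by (subst AE_distr_iff) (simp_all add: block_var_grid)
  then have "AE y in distr M borel (\<lambda>\<omega>. noise_diff \<omega> (grid n)). y = 0"
    by (simp only: block_distr[OF subset_refl])
  then show ?thesis
    by (subst (asm) AE_distr_iff) (use measurable_block[OF subset_refl] in simp_all)
qed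

abbreviation cell_block :: "nat \<Rightarrow> int \<times> int \<Rightarrow> (real \<times> real) set" where
  "cell_block j k \<equiv> {x \<in> grid n. dyadic_cell j x = k}"

text \<open>
  A cell with \<open>N\<close> pixels contributes at most \<open>2\<sigma> / \<surd>\<pi> \<cdot> \<surd>N\<close>. There are at most \<open>4\<^sup>j\<close> cells and \<open>n\<^sup>2\<close>
pixels, so the Cauchy-Schwarz inequality bounds the sum of the \<open>\<surd>N\<close> by \<open>\<surd>(4\<^sup>j n\<^sup>2)\<close>.
\<close>

lemma level_discrepancy:
  shows "integrable M (\<lambda>\<omega>. \<Sum>k\<in>dyadic_cell j ` grid n. \<bar>noise_diff \<omega> (cell_block j k)\<bar>)" (is ?int)
    and "expectation (\<lambda>\<omega>. \<Sum>k\<in>dyadic_cell j ` grid n. \<bar>noise_diff \<omega> (cell_block j k)\<bar>)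
       \<le> 2 * \<sigma> / sqrt pi * (2 ^ j * real n)" (is ?le)
proof -
  let ?K = "dyadic_cell j ` grid n"
  have sub: "cell_block j k \<subseteq> grid n" for k by auto
  show ?int
    by (intro Bochner_Integration.integrable_sum block_abs_expectation sub)
  have "expectation (\<lambda>\<omega>. \<Sum>k\<in>?K. \<bar>noise_diff \<omega> (cell_block j k)\<bar>) = (\<Sum>k\<in>?K. expectation (\<lambda>\<omega>. \<bar>noise_diff \<omega> (cell_block j k)\<bar>))"
    by (intro Bochner_Integration.integral_sum block_abs_expectation sub)
  also have "\<dots> \<le> (\<Sum>k\<in>?K. 2 * \<sigma> / sqrt pi * sqrt (card (cell_block j k)))"
    by (intro sum_mono block_abs_expectation sub)
  also have "\<dots> = 2 * \<sigma> / sqrt pi * (\<Sum>k\<in>?K. sqrt (card (cell_block j k)))"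
    by (rule sum_distrib_left[symmetric])
  also have "\<dots> \<le> 2 * \<sigma> / sqrt pi * (2 ^ j * real n)"
  proof (rule mult_left_mono)
    have "(\<Sum>k\<in>?K. card (cell_block j k)) = card (grid n)"
      using sum.image_gen[OF finite_grid, of "\<lambda>_. 1::nat" n "dyadic_cell j"] by simp
    then have mass: "(\<Sum>k\<in>?K. real (card (cell_block j k))) = (real n)\<^sup>2"
      using n2 by (simp add: card_grid flip: of_nat_sum)
    have "(\<Sum>k\<in>?K. 1 * sqrt (card (cell_block j k)))\<^sup>2 \<le> (\<Sum>k\<in>?K. 1\<^sup>2) * (\<Sum>k\<in>?K. (sqrt (card (cell_block j k)))\<^sup>2)"
      by (rule Cauchy_Schwarz_ineq_sum)
    also have "\<dots> = real (card ?K) * (real n)\<^sup>2"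
      using mass by simp
    also have "\<dots> \<le> 4 ^ j * (real n)\<^sup>2"
    proof (rule mult_right_mono)
      have "real (card ?K) \<le> real (4 ^ j)"
        by (rule of_nat_mono[OF card_dyadic_cells_le])
      then show "real (card ?K) \<le> 4 ^ j" by simp
    qed simp
    also have "\<dots> = (2 ^ j * real n)\<^sup>2"
      by (simp add: power2_eq_square flip: power_mult_distrib)
    finally have "(\<Sum>k\<in>?K. 1 * sqrt (card (cell_block j k))) \<le> 2 ^ j * real n"
      by (rule power2_le_imp_le) simp
    then show "(\<Sum>k\<in>?K. sqrt (card (cell_block j k))) \<le> 2 ^ j * real n"
      by simp
  qed (use sigma in simp)
  finally show ?le .
qed

end

section \<open>The expected signed Wasserstein discrepancy\<close>

lemma five_le_four_sqrt2: "5 \<le> 4 * sqrt 2"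
proof (rule power2_le_imp_le)
  show "5\<^sup>2 \<le> (4 * sqrt 2)\<^sup>2" by (simp add: power_mult_distrib)
qed simp

theorem theorem3p5:
  fixes \<eta> n p :: nat and \<sigma> :: real
    and \<mu> :: "real \<times> real \<Rightarrow> real"
    and M :: "'a measure"
    and \<epsilon>1 \<epsilon>2 :: "'a \<Rightarrow> real \<times> real \<Rightarrow> real"
  assumes "\<eta> \<ge> 1" and "n = 2 ^ \<eta>"
    and "\<mu> \<in> grid n \<rightarrow> {0..1}" and "(\<Sum>x\<in>grid n. \<mu> x) = 1"
    and "\<sigma> > 0"
    and "prob_space M"
    and "zero_sum_gaussian_noise M n \<sigma> \<epsilon>1"
    and "zero_sum_gaussian_noise M n \<sigma> \<epsilon>2"
    and "prob_space.indep_var M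
           (\<Pi>\<^sub>M x\<in>grid n. borel) (\<lambda>\<omega>. restrict (\<epsilon>1 \<omega>) (grid n))
           (\<Pi>\<^sub>M x\<in>grid n. borel) (\<lambda>\<omega>. restrict (\<epsilon>2 \<omega>) (grid n))"
    and "p > 1"
  defines "W \<equiv> \<lambda>\<omega>. signed_wasserstein n p (\<lambda>x. \<mu> x + \<epsilon>1 \<omega> x) (\<lambda>x. \<mu> x + \<epsilon>2 \<omega> x)"
    and "C \<equiv> 2 powr (1 / real p - 1) / sqrt pi * Gamma (1 / (2 * real p) + 1 / 2)"
  shows "integrable M (\<lambda>\<omega>. W \<omega> ^ p) \<and>
         prob_space.expectation M (\<lambda>\<omega>. W \<omega> ^ p) \<le> 4 * sqrt 2 / sqrt pi * real n * \<sigma> \<and>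
         integrable M W \<and>
         C * real n powr (2 / real p - 1) * \<sigma> powr (1 / real p) \<le> prob_space.expectation M W \<and>
         prob_space.expectation M W \<le> (4 * sqrt 2 / sqrt pi * real n * \<sigma>) powr (1 / real p)"
proof -
  have n2: "2 \<le> n"
    using power_increasing[OF assms(1), of "2::nat"] assms(2) by simp
  interpret noise_pair M n \<sigma> \<epsilon>1 \<epsilon>2
    by (intro noise_pair.intro noise_pair_axioms.intro assms n2)
  have p: "2 \<le> p" using \<open>p > 1\<close> by simp
  define s where "s = 1 / real p"
  have s: "0 < s" "s \<le> 1" using p by (simp_all add: s_def)
  define \<alpha> where "\<alpha> \<omega> x = max (\<mu> x + \<epsilon>1 \<omega> x) 0 + max (- (\<mu> x + \<epsilon>2 \<omega> x)) 0" for \<omega> x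
  define \<beta> where "\<beta> \<omega> x = max (\<mu> x + \<epsilon>2 \<omega> x) 0 + max (- (\<mu> x + \<epsilon>1 \<omega> x)) 0" for \<omega> x
  define V where "V \<omega> = (INF \<pi>\<in>couplings n (\<alpha> \<omega>) (\<beta> \<omega>). plan_cost n p \<pi>)" for \<omega>
  have W: "W \<omega> = V \<omega> powr s" for \<omega>
    unfolding W_def V_def \<alpha>_def \<beta>_def s_def signed_wasserstein_def wasserstein_def plan_cost_def ..
  have nonneg: "0 \<le> \<alpha> \<omega> x" "0 \<le> \<beta> \<omega> x" for \<omega> x
    by (simp_all add: \<alpha>_def \<beta>_def)
  have diff: "\<alpha> \<omega> x - \<beta> \<omega> x = \<epsilon>1 \<omega> x - \<epsilon>2 \<omega> x" for \<omega> x
    by (simp add: \<alpha>_def \<beta>_def max_def)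
  have block: "(\<Sum>x\<in>Q. \<alpha> \<omega> x - \<beta> \<omega> x) = noise_diff \<omega> Q" for \<omega> Q
    unfolding noise_diff_def diff ..

  have V_meas [measurable]: "V \<in> borel_measurable M"
    unfolding V_def
  proof (rule measurable_optimal_cost)
    fix x assume [measurable]: "x \<in> grid n"
    show "(\<lambda>\<omega>. \<alpha> \<omega> x) \<in> borel_measurable M" "(\<lambda>\<omega>. \<beta> \<omega> x) \<in> borel_measurable M"
      unfolding \<alpha>_def \<beta>_def using measurable_noise[OF \<open>x \<in> grid n\<close>] by measurable
  qed (rule nonneg)+

  \<comment> \<open>The random upper and lower bounds that transport theory gives for \<open>V\<close> and \<open>W\<close>.\<close>
  define U where "U \<omega> = (\<Sum>j<\<eta>. cell_diam2 j / 2 *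
      (\<Sum>k\<in>dyadic_cell (Suc j) ` grid n. \<bar>noise_diff \<omega> (cell_block (Suc j) k)\<bar>))" for \<omega>
  define L where "L \<omega> = real n powr (2 / real p - 1) * (1 / 2) powr s
      * ((\<Sum>x\<in>grid n. \<bar>noise_diff \<omega> {x}\<bar> powr s) / (real n)\<^sup>2)" for \<omega>
  have bounds: "0 \<le> V \<omega> \<and> V \<omega> \<le> U \<omega> \<and> L \<omega> \<le> W \<omega>" if "noise_diff \<omega> (grid n) = 0" for \<omega>
  proof -
    have mass: "sum (\<alpha> \<omega>) (grid n) = sum (\<beta> \<omega>) (grid n)"
      using block[of \<omega> "grid n"] that by (simp add: sum_subtractf)
    have ne: "couplings n (\<alpha> \<omega>) (\<beta> \<omega>) \<noteq> {}"
      by (rule couplings_nonempty[OF nonneg mass])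
    have low: "(1 / real n) ^ p * ((\<Sum>x\<in>grid n. \<bar>noise_diff \<omega> {x}\<bar>) / 2) \<le> V \<omega>"
      using optimal_cost_ge[OF ne, of p] p unfolding V_def diff by (simp add: noise_diff_def)
    then have "0 \<le> V \<omega>"
      by (rule order_trans[rotated]) (intro mult_nonneg_nonneg divide_nonneg_nonneg sum_nonneg; simp)
    moreover have "V \<omega> \<le> U \<omega>"
      using optimal_cost_le_multiscale[OF nonneg mass assms(2) p] unfolding V_def U_def block .
    moreover have "L \<omega> \<le> W \<omega>"
      unfolding L_def W s_def using n2
      by (intro root_cost_ge_mean_roots[OF finite_grid card_grid _ p low]) simp_all
    ultimately show ?thesis by blast
  qed
  have AE_bounds: "AE \<omega> in M. 0 \<le> V \<omega> \<and> V \<omega> \<le> U \<omega> \<and> L \<omega> \<le> W \<omega>"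
    using AE_total_zero by eventually_elim (rule bounds)

  have U_int: "integrable M U"
    unfolding U_def by (intro Bochner_Integration.integrable_sum integrable_mult_right level_discrepancy)
  have U_exp: "expectation U \<le> 4 * sqrt 2 / sqrt pi * real n * \<sigma>"
  proof -
    have "expectation U = (\<Sum>j<\<eta>. cell_diam2 j / 2 *
        expectation (\<lambda>\<omega>. \<Sum>k\<in>dyadic_cell (Suc j) ` grid n. \<bar>noise_diff \<omega> (cell_block (Suc j) k)\<bar>))"
      unfolding U_def
      by (subst Bochner_Integration.integral_sum)
         (simp_all only: integral_mult_right_zero integrable_mult_right level_discrepancy)
    also have "\<dots> \<le> (\<Sum>j<\<eta>. cell_diam2 j / 2 * (2 * \<sigma> / sqrt pi * (2 ^ Suc j * real n)))"
      by (intro sum_mono mult_left_mono level_discrepancy) (simp add: cell_diam2_def)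
    also have "\<dots> = (\<Sum>j<\<eta>. (real n * \<sigma> / sqrt pi) * (cell_diam2 j * 2 ^ Suc j))"
      by (rule sum.cong) simp_all
    also have "\<dots> = real n * \<sigma> / sqrt pi * (\<Sum>j<\<eta>. cell_diam2 j * 2 ^ Suc j)"
      by (rule sum_distrib_left[symmetric])
    also have "\<dots> \<le> real n * \<sigma> / sqrt pi * (4 * sqrt 2)"
      using sigma order_trans[OF sum_cell_diam2_le five_le_four_sqrt2] by (intro mult_left_mono) simp_all
    finally show ?thesis by (simp add: mult_ac)
  qed

  have W_meas [measurable]: "W \<in> borel_measurable M"
    unfolding W by measurable
  have W0: "0 \<le> W \<omega>" for \<omega>
    unfolding W by simp
  \<comment> \<open>Only almost everywhere: where the total noise is nonzero, \<open>V\<close> is an unspecified constant, possibly negative.\<close>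
  have AE_pow: "AE \<omega> in M. W \<omega> ^ p = V \<omega>"
    using AE_bounds
  proof eventually_elim
    case (elim \<omega>)
    then show ?case
      using p unfolding W s_def by (cases "V \<omega> = 0") (simp_all add: powr_powr flip: powr_realpow)
  qed
  have AE_pow_le: "AE \<omega> in M. W \<omega> ^ p \<le> U \<omega>"
    using AE_pow AE_bounds by eventually_elim simp
  have pow_int: "integrable M (\<lambda>\<omega>. W \<omega> ^ p)"
  proof (rule Bochner_Integration.integrable_bound[OF U_int])
    show "AE \<omega> in M. norm (W \<omega> ^ p) \<le> norm (U \<omega>)"
      using AE_pow_le by eventually_elim (use W0 in simp)
  qed measurable
  have pow_exp: "expectation (\<lambda>\<omega>. W \<omega> ^ p) \<le> 4 * sqrt 2 / sqrt pi * real n * \<sigma>"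
    using integral_mono_AE[OF pow_int U_int AE_pow_le] U_exp by linarith
  have W_int: "integrable M W"
  proof (rule Bochner_Integration.integrable_bound)
    show "integrable M (\<lambda>\<omega>. 1 + W \<omega> ^ p)"
      using pow_int by simp
    have "W \<omega> \<le> 1 + W \<omega> ^ p" for \<omega>
    proof (cases "W \<omega> \<le> 1")
      case True
      then show ?thesis using W0[of \<omega>] by (simp add: add_increasing2)
    next
      case False
      then show ?thesis using self_le_power[of "W \<omega>" p] p by simp
    qed
    then show "AE \<omega> in M. norm (W \<omega>) \<le> norm (1 + W \<omega> ^ p)"
      using W0 by simp
  qed measurable

  have "expectation W = (expectation W ^ p) powr s"
    using p W0 unfolding s_def
    by (cases "expectation W = 0") (simp_all add: powr_powr less_le flip: powr_realpow)
  also have "\<dots> \<le> (4 * sqrt 2 / sqrt pi * real n * \<sigma>) powr s"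
    using power_expectation_le[OF W_int pow_int W0 p] pow_exp W0 s
    by (intro powr_mono2) simp_all
  finally have upper: "expectation W \<le> (4 * sqrt 2 / sqrt pi * real n * \<sigma>) powr (1 / real p)"
    unfolding s_def .

  define \<gamma> where "\<gamma> = Gamma (1 / (2 * real p) + 1 / 2) / sqrt pi"
  have \<gamma>: "0 \<le> \<gamma>"
    unfolding \<gamma>_def by (intro divide_nonneg_nonneg less_imp_le[OF Gamma_real_pos] add_pos_nonneg) (use p in simp_all)
  have pixel: "integrable M (\<lambda>\<omega>. \<bar>noise_diff \<omega> {x}\<bar> powr s)"
      "expectation (\<lambda>\<omega>. \<bar>noise_diff \<omega> {x}\<bar> powr s) = (2 * \<sigma>) powr s * \<gamma>" if "x \<in> grid n" for x
  proof -
    have "(s + 1) / 2 = 1 / (2 * real p) + 1 / 2"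
      by (simp add: s_def add_divide_distrib)
    then have \<gamma>_s: "\<gamma> = Gamma ((s + 1) / 2) / sqrt pi"
      by (simp only: \<gamma>_def)
    show "integrable M (\<lambda>\<omega>. \<bar>noise_diff \<omega> {x}\<bar> powr s)"
      "expectation (\<lambda>\<omega>. \<bar>noise_diff \<omega> {x}\<bar> powr s) = (2 * \<sigma>) powr s * \<gamma>"
      using block_abs_moment[of "{x}" s] that s sigma by (simp_all add: block_var_singleton \<gamma>_s)
  qed
  have L_int: "integrable M L"
    unfolding L_def
    by (intro integrable_mult_right integrable_divide Bochner_Integration.integrable_sum pixel) auto
  have "expectation L = real n powr (2 / real p - 1) * (1 / 2) powr s
      * ((\<Sum>x\<in>grid n. expectation (\<lambda>\<omega>. \<bar>noise_diff \<omega> {x}\<bar> powr s)) / (real n)\<^sup>2)"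
    unfolding L_def using pixel(1)
    by (simp add: Bochner_Integration.integral_sum)
  also have "\<dots> = real n powr (2 / real p - 1) * (1 / 2) powr s * ((2 * \<sigma>) powr s * \<gamma>)"
    using n2 by (simp add: pixel(2) card_grid)
  also have "\<dots> = real n powr (2 / real p - 1) * (((1 / 2) powr s * (2 * \<sigma>) powr s) * \<gamma>)"
    by simp
  also have "(1 / 2) powr s * (2 * \<sigma>) powr s = \<sigma> powr s"
    using sigma by (subst powr_mult[symmetric]) simp_all
  finally have L_exp: "expectation L = \<gamma> * real n powr (2 / real p - 1) * \<sigma> powr s"
    by simp
  \<comment> \<open>The lower bound proved so far has the constant \<open>\<gamma>\<close>, which exceeds \<open>C\<close> by the factor \<open>2 powr (1 - 1 / p)\<close>.\<close>
  have "C = 2 powr (s - 1) * \<gamma>"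
    unfolding C_def \<gamma>_def s_def by simp
  also have "\<dots> \<le> 1 * \<gamma>"
  proof (rule mult_right_mono[OF _ \<gamma>])
    have "(2::real) powr (s - 1) \<le> 2 powr 0"
      using s by (intro powr_mono) auto
    then show "(2::real) powr (s - 1) \<le> 1" by simp
  qed
  finally have "C * real n powr (2 / real p - 1) * \<sigma> powr s \<le> expectation L"
    unfolding L_exp by (intro mult_right_mono) simp_all
  also have "\<dots> \<le> expectation W"
    by (rule integral_mono_AE[OF L_int W_int]) (use AE_bounds in eventually_elim, simp)
  finally have lower: "C * real n powr (2 / real p - 1) * \<sigma> powr (1 / real p) \<le> expectation W"
    unfolding s_def .

  from pow_int pow_exp W_int lower upper show ?thesis
    by blast
qed

end
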